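(* For every graph $G$ and every $\epsilon\ge0$, $\lceil\vartheta^+(\overline G)\rceil\le\Psi_\epsilon(G)$, with equality if $\epsilon=0$.
   Context: Graphs are finite, undirected, without loops, with at least one vertex; $\overline G$ is the complement of $G$; $[t]=\{1,\dots,t\}$. $\mathcal S^d$ denotes the real symmetric $d\times d$ matrices; $\mathcal{DNN}^n$ is the cone of positive semidefinite matrices in $\mathcal S^n$ with nonnegative entries; $J$ is the all-ones matrix. With $n=|V(G)|$, $\vartheta^+(\overline G)$ is the minimum $t\in\mathbb R$ for which there is $Z\in\mathcal{DNN}^n$ (indexed by $V(G)$) with $Z-J\succeq0$, $Z_{uu}=t$ for all $u\in V(G)$, and $Z_{uv}=0$ for all $\{u,v\}\in E(G)$. Sets $\mathcal K_{\mathrm{nc},\epsilon}$. For $N\ge1$, $\mathbb R\langle\underline X\rangle$ is the ring of real polynomials in non-commutative variables $X_1,\dots,X_N$, with the linear involution $*$ fixing each variable and reversing each monomial. A commutator is $[f,g]=fg-gf$. $\mathrm{tr}\mathcal M^{\mathrm{ball}}_{\mathrm{nc}}$ is the set of polynomials $h+\sum_{j=1}^{m_0}f_jf_j^*+\sum_{j=1}^{m_1}g_j(1-\sum_{i=1}^NX_i^2)g_j^*$ with $h$ a sum of commutators, $f_j,g_j\in\mathbb R\langle\underline X\rangle$, $m_0,m_1\in\mathbb N$. For $M\in\mathcal S^N$, $p_M=\sum_{i,j=1}^NM_{ij}X_i^2X_j^2$, and $\mathcal K_{\mathrm{nc},\epsilon}=\{M\in\mathcal S^N:p_M+\epsilon\in\mathrm{tr}\mathcal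 M^{\mathrm{ball}}_{\mathrm{nc}}\}$. The parameter $\Psi_\epsilon(G)$. Let $n=|V(G)|$ and $N=\sum_{t=1}^n(nt+1)$. View $\mathcal S^N$ as block matrices with $n$ diagonal blocks, the $t$-th block being indexed by $\{0\}\cup(V(G)\times[t])$ ($ui$ abbreviates $(u,i)$). For $u\in V(G)$, $A_u^t\in\mathcal S^{nt+1}$ has entries $A_u^t(0,0)=A_u^t(ui,uj)=1$ for $i,j\in[t]$, $A_u^t(0,ui)=A_u^t(ui,0)=-1$ for $i\in[t]$, zero elsewhere; $A^t=\sum_{u}A_u^t$ and $A=\bigoplus_{t=1}^nA^t$. Let $E^t_{a,b}\in\mathcal S^{nt+1}$ be the elementary symmetric matrices (supported at positions $(a,b)$ and $(b,a)$), and $\widetilde E^t_{a,b}\in\mathcal S^N$ their extension by zeros outside the $t$-th block. Let $C=\bigoplus_{t=1}^nt\,E^t_{0,0}$ and $B=\bigoplus_{t=1}^nE^t_{0,0}$. Then $\Psi_\epsilon(G)$ is the supremum of $\lambda$ over all real $\lambda,\mu,y^t_{u,v,i},z^t_{u,i,j}$ such that $$C-\lambda B-\mu A-\sum y^t_{u,v,i}\widetilde E^t_{ui,vi}-\sum z^t_{u,i,j}\widetilde E^t_{ui,uj}\in\mathcal K_{\mathrm{nc},\epsilon},$$ where the first sum is over $t\in[n]$, $i\in[t]$, $\{u,v\}\in E(G)$ and the second over $t\in[n]$, $i\ne j\in[t]$, $u\in V(G)$. *)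

theory Defs
  imports "HOL-Analysis.Analysis" "HOL-Library.Poly_Mapping" "HOL-Library.Extended_Real"
begin

section \<open>Graphs\<close>

definition simple_graph :: "'v set \<Rightarrow> 'v set set \<Rightarrow> bool" where
  "simple_graph V E \<longleftrightarrow> finite V \<and> V \<noteq> {} \<and> (\<forall>e\<in>E. \<exists>u\<in>V. \<exists>v\<in>V. u \<noteq> v \<and> e = {u, v})"

definition complement_edges :: "'v set \<Rightarrow> 'v set set \<Rightarrow> 'v set set" where
  "complement_edges V E = {{u, v} |u v. u \<in> V \<and> v \<in> V \<and> u \<noteq> v \<and> {u, v} \<notin> E}"


section \<open>Matrices indexed by a finite set\<close>

text \<open>A real matrix with rows and columns indexed by a finite set \<open>I\<close> is a function
  \<open>'i \<Rightarrow> 'i \<Rightarrow> real\<close> of which only the entries in \<open>I \<times> I\<close> matter.\<close>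

type_synonym 'i mat = "'i \<Rightarrow> 'i \<Rightarrow> real"

definition symmetric_on :: "'i set \<Rightarrow> 'i mat \<Rightarrow> bool" where
  "symmetric_on I M \<longleftrightarrow> (\<forall>i\<in>I. \<forall>j\<in>I. M i j = M j i)"

definition psd_on :: "'i set \<Rightarrow> 'i mat \<Rightarrow> bool" where
  "psd_on I M \<longleftrightarrow> symmetric_on I M \<and> (\<forall>x. 0 \<le> (\<Sum>i\<in>I. \<Sum>j\<in>I. x i * M i j * x j))"

definition dnn_on :: "'i set \<Rightarrow> 'i mat \<Rightarrow> bool" where
  "dnn_on I M \<longleftrightarrow> psd_on I M \<and> (\<forall>i\<in>I. \<forall>j\<in>I. 0 \<le> M i j)"


section \<open>The parameter \<open>\<vartheta>\<^sup>+\<close>\<close>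

definition theta_plus_feasible :: "'v set \<Rightarrow> 'v set set \<Rightarrow> real \<Rightarrow> bool" where
  "theta_plus_feasible V E t \<longleftrightarrow>
     (\<exists>Z. dnn_on V Z \<and> psd_on V (\<lambda>u v. Z u v - 1) \<and> (\<forall>u\<in>V. Z u u = t)
        \<and> (\<forall>u\<in>V. \<forall>v\<in>V. {u, v} \<in> complement_edges V E \<longrightarrow> Z u v = 0))"

text \<open>This is the parameter of the graph \<open>(V, E)\<close> itself, so the zero pattern is that of the
  complement. On a linear order, \<open>Least\<close> denotes an attained minimum, not an infimum.\<close>

definition theta_plus :: "'v set \<Rightarrow> 'v set set \<Rightarrow> real" where
  "theta_plus V E = (LEAST t. theta_plus_feasible V E t)"

lemma complement_complement_edges:
  assumes "simple_graph V E"
  shows "complement_edges V (complement_edges V E) = E"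
proof (intro set_eqI iffI)
  fix e assume "e \<in> complement_edges V (complement_edges V E)"
  then show "e \<in> E" unfolding complement_edges_def by blast
next
  fix e assume e: "e \<in> E"
  then obtain u v where "u \<in> V" "v \<in> V" "u \<noteq> v" "e = {u, v}"
    using assms unfolding simple_graph_def by blast
  moreover have "{u, v} \<notin> complement_edges V E"
    using e \<open>e = {u, v}\<close> unfolding complement_edges_def by auto
  ultimately show "e \<in> complement_edges V (complement_edges V E)"
    unfolding complement_edges_def[of V "complement_edges V E"] by blast
qed

lemma theta_plus_feasible_complement:
  assumes "simple_graph V E"
  shows "theta_plus_feasible V (complement_edges V E) t \<longleftrightarrow>
     (\<exists>Z. dnn_on V Z \<and> psd_on V (\<lambda>u v. Z u v - 1) \<and> (\<forall>u\<in>V. Z u u = t)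
        \<and> (\<forall>u\<in>V. \<forall>v\<in>V. {u, v} \<in> E \<longrightarrow> Z u v = 0))"
  unfolding theta_plus_feasible_def complement_complement_edges[OF assms] ..


section \<open>Non-commutative polynomials\<close>

text \<open>The free monoid, written additively so that \<open>'i ncpoly\<close> below, with the
  convolution product of \<^theory>\<open>HOL-Library.Poly_Mapping\<close>, is its real monoid algebra.\<close>

datatype 'i monomial = Monomial (letters: "'i list")

instantiation monomial :: (type) monoid_add
begin

definition zero_monomial :: "'a monomial" where
  "zero_monomial = Monomial []"

definition plus_monomial :: "'a monomial \<Rightarrow> 'a monomial \<Rightarrow> 'a monomial" where
  "plus_monomial v w = Monomial (letters v @ letters w)"

instance
  by standard (simp_all add: zero_monomial_def plus_monomial_def)

end

type_synonym 'i ncpoly = "'i monomial \<Rightarrow>\<^sub>0 real"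

definition nc_const :: "real \<Rightarrow> 'i ncpoly" where
  "nc_const c = Poly_Mapping.single 0 c"

definition nc_var :: "'i \<Rightarrow> 'i ncpoly" where
  "nc_var i = Poly_Mapping.single (Monomial [i]) 1"

definition monomial_rev :: "'i monomial \<Rightarrow> 'i monomial" where
  "monomial_rev w = Monomial (rev (letters w))"

lemma monomial_rev_rev [simp]: "monomial_rev (monomial_rev w) = w"
  by (simp add: monomial_rev_def)

lemma inj_monomial_rev: "inj monomial_rev"
  by (metis injI monomial_rev_rev)

definition nc_star :: "'i ncpoly \<Rightarrow> 'i ncpoly" where
  "nc_star f = Poly_Mapping.map_key monomial_rev f"

lemma lookup_nc_star:
  "Poly_Mapping.lookup (nc_star f) w = Poly_Mapping.lookup f (monomial_rev w)"
  by (simp add: nc_star_def map_key.rep_eq inj_monomial_rev)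

lemma nc_star_single:
  "nc_star (Poly_Mapping.single (Monomial ws) c) = Poly_Mapping.single (Monomial (rev ws)) c"
  using map_key_single[OF inj_monomial_rev, of "Monomial (rev ws)" c]
  by (simp add: nc_star_def monomial_rev_def)

text \<open>The polynomials in the variables \<open>X\<^sub>i\<close>, \<open>i \<in> I\<close>.\<close>

definition nc_polys :: "'i set \<Rightarrow> 'i ncpoly set" where
  "nc_polys I = {f. \<forall>w \<in> Poly_Mapping.keys f. set (letters w) \<subseteq> I}"

definition tr_qmodule_ball :: "'i set \<Rightarrow> 'i ncpoly set" where
  "tr_qmodule_ball I = {p. \<exists>cs fs gs.
     set cs \<subseteq> nc_polys I \<times> nc_polys I \<and> set fs \<subseteq> nc_polys I \<and> set gs \<subseteq> nc_polys I \<and>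
     p = (\<Sum>(f, g) \<leftarrow> cs. f * g - g * f) + (\<Sum>f \<leftarrow> fs. f * nc_star f)
         + (\<Sum>g \<leftarrow> gs. g * (1 - (\<Sum>i\<in>I. nc_var i ^ 2)) * nc_star g)}"

definition mat_poly :: "'i set \<Rightarrow> 'i mat \<Rightarrow> 'i ncpoly" where
  "mat_poly I M = (\<Sum>i\<in>I. \<Sum>j\<in>I. nc_const (M i j) * (nc_var i ^ 2 * nc_var j ^ 2))"

definition K_nc :: "real \<Rightarrow> 'i set \<Rightarrow> 'i mat set" where
  "K_nc \<epsilon> I = {M. symmetric_on I M \<and> mat_poly I M + nc_const \<epsilon> \<in> tr_qmodule_ball I}"


section \<open>The parameter \<open>\<Psi>\<^sub>\<epsilon>\<close>\<close>

text \<open>In a block, \<open>None\<close> is the index \<open>0\<close> and \<open>Some (u, i)\<close> is the index \<open>ui\<close>;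
  the pair \<open>(t, a)\<close> is the index \<open>a\<close> of the \<open>t\<close>-th block.\<close>

type_synonym 'v bidx = "('v \<times> nat) option"

definition block_index :: "'v set \<Rightarrow> nat \<Rightarrow> 'v bidx set" where
  "block_index V t = insert None (Some ` (V \<times> {1..t}))"

definition full_index :: "'v set \<Rightarrow> (nat \<times> 'v bidx) set" where
  "full_index V = (SIGMA t : {1..card V}. block_index V t)"

lemma card_full_index:
  assumes "finite V"
  shows "finite (full_index V)" "card (full_index V) = (\<Sum>t = 1..card V. card V * t + 1)"
proof -
  have fin: "finite (block_index V t)" for t
    using assms by (simp add: block_index_def)
  have "card (block_index V t) = card V * t + 1" for t
  proof -
    have "None \<notin> Some ` (V \<times> {1..t})" by blast
    then show ?thesis
      using assms by (simp add: block_index_def card_image card_cartesian_product)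
  qed
  then show "card (full_index V) = (\<Sum>t = 1..card V. card V * t + 1)"
    using fin by (simp add: full_index_def)
  show "finite (full_index V)"
    using fin by (simp add: full_index_def)
qed

definition direct_sum :: "(nat \<Rightarrow> 'b mat) \<Rightarrow> (nat \<times> 'b) mat" where
  "direct_sum D = (\<lambda>(s, a) (t, b). if s = t then D t a b else 0)"

text \<open>\<open>elem_sym {a, b}\<close> has entry 1 at the positions \<open>(a, b)\<close> and \<open>(b, a)\<close>, and
  \<open>elem_sym {a}\<close> at \<open>(a, a)\<close>. Taking the unordered pair as argument allows summation over
  undirected edges.\<close>

definition elem_sym :: "'b set \<Rightarrow> 'b mat" where
  "elem_sym S = (\<lambda>a b. if {a, b} = S then 1 else 0)"

definition elem_sym_ext :: "nat \<Rightarrow> 'b set \<Rightarrow> (nat \<times> 'b) mat" where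
  "elem_sym_ext t S = direct_sum (\<lambda>s a b. if s = t then elem_sym S a b else 0)"

fun A_vertex :: "'v \<Rightarrow> 'v bidx mat" where
  "A_vertex u None None = 1"
| "A_vertex u None (Some (w, j)) = (if w = u then -1 else 0)"
| "A_vertex u (Some (v, i)) None = (if v = u then -1 else 0)"
| "A_vertex u (Some (v, i)) (Some (w, j)) = (if v = u \<and> w = u then 1 else 0)"

definition A_mat :: "'v set \<Rightarrow> (nat \<times> 'v bidx) mat" where
  "A_mat V = direct_sum (\<lambda>t a b. \<Sum>u\<in>V. A_vertex u a b)"

definition B_mat :: "(nat \<times> 'v bidx) mat" where
  "B_mat = direct_sum (\<lambda>t. elem_sym {None})"

definition C_mat :: "(nat \<times> 'v bidx) mat" where
  "C_mat = direct_sum (\<lambda>t a b. real t * elem_sym {None} a b)"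

text \<open>For an edge \<open>e = {u, v}\<close>, \<open>y t e i\<close> is the multiplier \<open>y\<^sup>t\<^bsub>u,v,i\<^esub>\<close> and the image of \<open>e\<close>
  below is \<open>{ui, vi}\<close>.\<close>

definition Psi_matrix :: "'v set \<Rightarrow> 'v set set \<Rightarrow> real \<Rightarrow> real \<Rightarrow>
    (nat \<Rightarrow> 'v set \<Rightarrow> nat \<Rightarrow> real) \<Rightarrow> (nat \<Rightarrow> 'v \<Rightarrow> nat \<Rightarrow> nat \<Rightarrow> real) \<Rightarrow> (nat \<times> 'v bidx) mat" where
  "Psi_matrix V E l \<mu> y z = (\<lambda>p q.
     C_mat p q - l * B_mat p q - \<mu> * A_mat V p q
     - (\<Sum>t = 1..card V. \<Sum>i = 1..t. \<Sum>e\<in>E.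
          y t e i * elem_sym_ext t ((\<lambda>u. Some (u, i)) ` e) p q)
     - (\<Sum>t = 1..card V. \<Sum>i = 1..t. \<Sum>j \<in> {1..t} - {i}. \<Sum>u\<in>V.
          z t u i j * elem_sym_ext t {Some (u, i), Some (u, j)} p q))"

definition Psi :: "real \<Rightarrow> 'v set \<Rightarrow> 'v set set \<Rightarrow> ereal" where
  "Psi \<epsilon> V E = Sup {ereal l |l \<mu> y z. Psi_matrix V E l \<mu> y z \<in> K_nc \<epsilon> (full_index V)}"

end

theory Submission
  imports Defs
begin

text \<open>
  For \<open>\<epsilon> = 0\<close> the set \<open>K_nc\<close> is the dual of the doubly nonnegative cone, that is, the sum of the
  positive semidefinite and the nonnegative matrices. Indeed \<open>p\<^sub>M\<close> has no terms of degree below 4, so in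
  a certificate the terms of degree below 2 of all \<open>f\<^sub>j, g\<^sub>j\<close> vanish, and the degree 4 part of what is
  left pairs nonnegatively with every doubly nonnegative \<open>X\<close>. Conversely \<open>X\<^sub>i\<^sup>2 X\<^sub>j\<^sup>2\<close> is a Hermitian
  square up to a commutator.

  The program defining \<open>\<Psi>\<close> is thus dual to a conic program with one block for each \<open>t \<le> n\<close>, and block
  \<open>t\<close> has a solution (which bounds \<open>\<lambda>\<close> by \<open>t\<close>) iff \<open>\<vartheta>\<^sup>+ \<le> t\<close>. For \<open>t < \<vartheta>\<^sup>+\<close> infeasibility of the block
  is witnessed by a dual certificate, a multiple of which allows \<open>\<lambda> = \<lceil>\<vartheta>\<^sup>+\<rceil>\<close>; since every \<open>A\<^sup>t\<close>
  is positive semidefinite, a single \<open>\<mu>\<close> serves all the blocks.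
\<close>

subsection \<open>Positive semidefinite matrices\<close>

text \<open>A block is the doubly nonnegative relaxation of \<open>t\<close>-colourability: a
  colouring gives \<open>X = x x^T\<close>, where \<open>x\<close> is 1 at index 0 and at those
  \<open>ui\<close> for which \<open>u\<close> has colour \<open>i\<close>, and 0 elsewhere. It is
  matched with the program for theta-plus by the symmetry between the colours in one direction and
  by Cauchy-Schwarz over the \<open>t\<close> colours in the other. The delicate point is to get an
  exact certificate from infeasibility, as separation of cones by itself yields one only up to
  closure. A minimiser of a penalty function provides it, and exists because \<open>A\<close> and
  the zero pattern together bound the diagonal of \<open>X\<close>. The ball terms of a certificate
  are not homogeneous. Once the low degrees are stripped, the lowest part of
  \<open>g (1 - sum X_i^2) g*\<close> is that of \<open>g g*\<close>, so a functional living in that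
  degree sees a square. For \<open>\<epsilon> > 0\<close> the stripping cannot start: the degree 0
  functional takes the value \<open>\<epsilon>\<close> on the polynomial, not 0.\<close>

definition mat_inner :: "'i set \<Rightarrow> 'i mat \<Rightarrow> 'i mat \<Rightarrow> real" where
  "mat_inner I M X = (\<Sum>i\<in>I. \<Sum>j\<in>I. M i j * X i j)"

abbreviation qform :: "'i set \<Rightarrow> 'i mat \<Rightarrow> ('i \<Rightarrow> real) \<Rightarrow> real" where
  "qform I M x \<equiv> (\<Sum>i\<in>I. \<Sum>j\<in>I. x i * M i j * x j)"

lemma psd_onI:
  assumes "symmetric_on I M" "\<And>x. 0 \<le> qform I M x"
  shows "psd_on I M"
  using assms by (simp add: psd_on_def)

lemma psd_on_sym: "psd_on I M \<Longrightarrow> i \<in> I \<Longrightarrow> j \<in> I \<Longrightarrow> M i j = M j i"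
  by (simp add: psd_on_def symmetric_on_def)

lemma psd_on_qform: "psd_on I M \<Longrightarrow> 0 \<le> qform I M x"
  by (simp add: psd_on_def)

lemma psd_on_cong:
  assumes "\<And>i j. i \<in> I \<Longrightarrow> j \<in> I \<Longrightarrow> M i j = N i j"
  shows "psd_on I M \<longleftrightarrow> psd_on I N"
  using assms by (simp add: psd_on_def symmetric_on_def cong: sum.cong)

lemma psd_on_add:
  assumes "psd_on I M" "psd_on I N"
  shows "psd_on I (\<lambda>i j. M i j + N i j)"
proof (rule psd_onI)
  show "symmetric_on I (\<lambda>i j. M i j + N i j)"
    using assms by (simp add: psd_on_def symmetric_on_def)
  fix x
  have "qform I (\<lambda>i j. M i j + N i j) x = qform I M x + qform I N x"
    by (simp add: sum.distrib algebra_simps)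
  then show "0 \<le> qform I (\<lambda>i j. M i j + N i j) x"
    using psd_on_qform[OF assms(1), of x] psd_on_qform[OF assms(2), of x] by simp
qed

lemma psd_on_scale:
  assumes "psd_on I M" "0 \<le> c"
  shows "psd_on I (\<lambda>i j. c * M i j)"
proof (rule psd_onI)
  show "symmetric_on I (\<lambda>i j. c * M i j)"
    using assms by (simp add: psd_on_def symmetric_on_def)
  fix x
  have "qform I (\<lambda>i j. c * M i j) x = c * qform I M x"
    by (simp add: sum_distrib_left algebra_simps)
  then show "0 \<le> qform I (\<lambda>i j. c * M i j) x"
    using psd_on_qform[OF assms(1), of x] assms(2) by simp
qed

lemma psd_on_outer: "psd_on I (\<lambda>i j. v i * v j)"
proof (rule psd_onI)
  show "symmetric_on I (\<lambda>i j. v i * v j)"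
    by (simp add: symmetric_on_def)
  fix x
  have "qform I (\<lambda>i j. v i * v j) x = (\<Sum>i\<in>I. x i * v i) * (\<Sum>i\<in>I. x i * v i)"
    unfolding sum_product by (simp add: algebra_simps)
  then show "0 \<le> qform I (\<lambda>i j. v i * v j) x" by simp
qed

lemma psd_on_subset:
  assumes "finite I" "J \<subseteq> I" "psd_on I M"
  shows "psd_on J M"
proof (rule psd_onI)
  show "symmetric_on J M"
    using assms by (auto simp: psd_on_def symmetric_on_def)
  fix x :: "'a \<Rightarrow> real"
  let ?y = "\<lambda>i. if i \<in> J then x i else 0"
  have "qform J M x = (\<Sum>i\<in>J. \<Sum>j\<in>I. ?y i * M i j * ?y j)"
    using assms(1,2) by (intro sum.cong sum.mono_neutral_cong_left) auto
  also have "\<dots> = qform I M ?y"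
    using assms(1,2) by (intro sum.mono_neutral_left) auto
  finally show "0 \<le> qform J M x"
    using psd_on_qform[OF assms(3), of ?y] by simp
qed

lemma psd_on_diag:
  assumes "finite I" "psd_on I M" "i \<in> I"
  shows "0 \<le> M i i"
  using psd_on_qform[OF psd_on_subset[of I "{i}" M], of "\<lambda>_. 1"] assms by simp

lemma psd_on_pair:
  assumes "finite I" "psd_on I M" "i \<in> I" "j \<in> I"
  shows "0 \<le> s^2 * M i i + 2 * s * r * M i j + r^2 * M j j"
proof (cases "i = j")
  case True
  have "s^2 * M i i + 2 * s * r * M i j + r^2 * M j j = (s + r)^2 * M i i"
    using True by (simp add: power2_eq_square algebra_simps)
  then show ?thesis using psd_on_diag[OF assms(1-3)] by simp
next
  case False
  have "psd_on {i, j} M" using psd_on_subset[OF assms(1) _ assms(2), of "{i, j}"] assms(3,4) by simp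
  from psd_on_qform[OF this, of "\<lambda>k. if k = i then s else r"] False psd_on_sym[OF assms(2-4)]
  show ?thesis by (simp add: power2_eq_square algebra_simps)
qed

lemma psd_on_abs_le:
  assumes "finite I" "psd_on I M" "i \<in> I" "j \<in> I" "M i i \<le> R" "M j j \<le> R"
  shows "\<bar>M i j\<bar> \<le> R"
  using psd_on_pair[OF assms(1-4), of 1 1] psd_on_pair[OF assms(1-4), of 1 "-1"] assms(5,6)
  by (simp add: abs_le_iff)

lemma psd_on_zero_diag:
  assumes "finite I" "psd_on I M" "a \<in> I" "M a a = 0" "j \<in> I"
  shows "M a j = 0"
proof (rule ccontr)
  assume "M a j \<noteq> 0"
  \<comment> \<open>As \<open>M a a = 0\<close>, the form takes the value \<open>-1\<close> at this
    test vector.\<close>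
  then show False
    using psd_on_pair[OF assms(1-3,5), of "- (M j j + 1) / (2 * M a j)" 1] assms(4) by (simp add: field_simps)
qed

lemma qform_insert:
  assumes "finite I" "a \<notin> I" "symmetric_on (insert a I) M"
  shows "qform (insert a I) M x
    = M a a * (x a)^2 + 2 * x a * (\<Sum>j\<in>I. M a j * x j) + qform I M x"
proof -
  have "(\<Sum>i\<in>I. x i * M i a * x a) = x a * (\<Sum>j\<in>I. M a j * x j)"
    unfolding sum_distrib_left
  proof (rule sum.cong[OF refl])
    fix i assume "i \<in> I"
    then have "M i a = M a i" using assms(3) unfolding symmetric_on_def by blast
    then show "x i * M i a * x a = x a * (M a i * x i)" by simp
  qed
  moreover have "(\<Sum>j\<in>I. x a * M a j * x j) = x a * (\<Sum>j\<in>I. M a j * x j)"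
    by (simp add: sum_distrib_left algebra_simps)
  ultimately show ?thesis
    using assms(1,2) by (simp add: sum.distrib power2_eq_square algebra_simps)
qed

text \<open>Cholesky elimination: the row of \<open>a\<close> is split off as a rank-one term, and
  the induction hypothesis applies to the Schur complement that remains.\<close>

lemma psd_on_gram:
  fixes M :: "'i mat"
  assumes "finite I" "psd_on I M"
  shows "\<exists>n (v :: nat \<Rightarrow> 'i \<Rightarrow> real). \<forall>i\<in>I. \<forall>j\<in>I. M i j = (\<Sum>k<n. v k i * v k j)"
  using assms
proof (induction I arbitrary: M rule: finite_induct)
  case empty
  then show ?case by simp
next
  case (insert a I)
  let ?d = "M a a"
  \<comment> \<open>The Schur complement of the pivot. For pivot 0 the quotient is 0 by convention,
    which is right because row \<open>a\<close> then vanishes.\<close>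
  define M' where "M' i j = M i j - M a i * M a j / ?d" for i j
  have d: "0 \<le> ?d" using psd_on_diag[OF _ insert.prems, of a] insert.hyps by simp
  have sym: "symmetric_on (insert a I) M" using insert.prems by (simp add: psd_on_def)
  have zero: "M a j = 0" if "?d = 0" "j \<in> insert a I" for j
    using psd_on_zero_diag[OF _ insert.prems, of a j] insert.hyps that by simp
  have "psd_on I M'"
  proof (rule psd_onI)
    show "symmetric_on I M'"
      using sym unfolding symmetric_on_def M'_def by (metis insertCI mult.commute)
    fix x
    let ?s = "\<Sum>j\<in>I. M a j * x j"
    \<comment> \<open>For a nonzero pivot this value of coordinate \<open>a\<close> minimises the
      form of \<open>M\<close>, which turns it into the form of \<open>M'\<close>.\<close>
    let ?y = "x(a := - ?s / ?d)"
    have eqs: "(\<Sum>j\<in>I. M a j * ?y j) = ?s" "qform I M ?y = qform I M x"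
      using insert.hyps(2) by (auto intro!: sum.cong)
    have "qform (insert a I) M ?y = ?d * (?s / ?d)^2 - 2 * (?s / ?d) * ?s + qform I M x"
      unfolding qform_insert[OF insert.hyps sym] eqs by simp
    also have "\<dots> = qform I M x - ?s * ?s / ?d"
    proof (cases "?d = 0")
      case False
      then have "?d * (?s / ?d)^2 = ?s * ?s / ?d"
        by (simp add: power2_eq_square)
      then show ?thesis by simp
    qed simp
    also have "?s * ?s / ?d = (\<Sum>i\<in>I. \<Sum>j\<in>I. x i * (M a i * M a j / ?d) * x j)"
      unfolding sum_product sum_divide_distrib by (simp add: algebra_simps)
    also have "qform I M x - \<dots> = qform I M' x"
      by (simp add: M'_def sum_subtractf algebra_simps)
    finally have "qform (insert a I) M ?y = qform I M' x" .
    with psd_on_qform[OF insert.prems, of ?y] show "0 \<le> qform I M' x" by (simp only:)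
  qed
  from insert.IH[OF this] obtain n and v :: "nat \<Rightarrow> 'i \<Rightarrow> real"
    where v: "\<And>i j. i \<in> I \<Longrightarrow> j \<in> I \<Longrightarrow> M' i j = (\<Sum>k<n. v k i * v k j)" by blast
  define w where "w k i = (if k = n then M a i / sqrt ?d else if i = a then 0 else v k i)" for k i
  have "M i j = (\<Sum>k<Suc n. w k i * w k j)" if "i \<in> insert a I" "j \<in> insert a I" for i j
  proof -
    have "(\<Sum>k<Suc n. w k i * w k j) = M a i * M a j / ?d + (\<Sum>k<n. w k i * w k j)"
      using d by (simp add: w_def)
    also have "(\<Sum>k<n. w k i * w k j) = (if i = a \<or> j = a then 0 else M' i j)"
      using v that by (auto simp: w_def)
    finally have eq: "(\<Sum>k<Suc n. w k i * w k j) = M a i * M a j / ?d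
      + (if i = a \<or> j = a then 0 else M' i j)" .
    have "M i a = M a i" using that psd_on_sym[OF insert.prems] by simp
    then show ?thesis
      unfolding eq M'_def using zero[OF _ that(1)] zero[OF _ that(2)] by (cases "?d = 0") auto
  qed
  then show ?case by blast
qed

lemma qform_gram:
  assumes "\<And>i j. i \<in> I \<Longrightarrow> j \<in> I \<Longrightarrow> M i j = (\<Sum>k<n. v k i * v k j)"
  shows "qform I M x = (\<Sum>k<(n::nat). (\<Sum>i\<in>I. v k i * x i)^2)"
proof -
  have "(\<Sum>k<n. (\<Sum>i\<in>I. v k i * x i)^2)
      = (\<Sum>k<n. \<Sum>i\<in>I. \<Sum>j\<in>I. (v k i * x i) * (v k j * x j))"
    by (simp add: power2_eq_square sum_product)
  also have "\<dots> = (\<Sum>i\<in>I. \<Sum>k<n. \<Sum>j\<in>I. (v k i * x i) * (v k j * x j))"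
    by (rule sum.swap)
  also have "\<dots> = (\<Sum>i\<in>I. \<Sum>j\<in>I. \<Sum>k<n. (v k i * x i) * (v k j * x j))"
    by (intro sum.cong refl sum.swap)
  also have "\<dots> = qform I M x"
    by (intro sum.cong refl) (simp add: assms sum_distrib_left sum_distrib_right algebra_simps)
  finally show ?thesis ..
qed

text \<open>The form is a sum of squares of pairings with the Gram vectors. If it vanishes, so does
  each pairing, and the entries of \<open>M x\<close> are combinations of them.\<close>

lemma psd_on_kernel:
  assumes "finite I" "psd_on I M" "qform I M x = 0" "b \<in> I"
  shows "(\<Sum>j\<in>I. M b j * x j) = 0"
proof -
  from psd_on_gram[OF assms(1,2)] obtain n v
    where v: "\<And>i j. i \<in> I \<Longrightarrow> j \<in> I \<Longrightarrow> M i j = (\<Sum>k<(n::nat). v k i * v k j)" by blast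
  have "(\<Sum>k<n. (\<Sum>i\<in>I. v k i * x i)^2) = 0"
    using qform_gram[of I M v n x, OF v] assms(3) by simp
  then have z: "(\<Sum>i\<in>I. v k i * x i) = 0" if "k < n" for k
    using that by (simp add: sum_nonneg_eq_0_iff)
  have "(\<Sum>j\<in>I. M b j * x j) = (\<Sum>j\<in>I. \<Sum>k<n. v k b * (v k j * x j))"
    using assms(4) by (intro sum.cong refl) (simp add: v sum_distrib_left sum_distrib_right algebra_simps)
  also have "\<dots> = (\<Sum>k<n. v k b * (\<Sum>j\<in>I. v k j * x j))"
    by (subst sum.swap) (simp add: sum_distrib_left)
  finally show ?thesis using z by simp
qed

text \<open>The easy half of the self-duality of the positive semidefinite cone: Gram vectors of
  \<open>M\<close> are test vectors for \<open>X\<close>.\<close>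

lemma mat_inner_psd_nonneg:
  assumes "finite I" "psd_on I M" "psd_on I X"
  shows "0 \<le> mat_inner I M X"
proof -
  from psd_on_gram[OF assms(1,2)] obtain n v
    where v: "\<And>i j. i \<in> I \<Longrightarrow> j \<in> I \<Longrightarrow> M i j = (\<Sum>k<(n::nat). v k i * v k j)" by blast
  have "mat_inner I M X = (\<Sum>i\<in>I. \<Sum>j\<in>I. \<Sum>k<n. v k i * X i j * v k j)"
    unfolding mat_inner_def
    by (intro sum.cong refl) (simp add: v sum_distrib_left sum_distrib_right algebra_simps)
  also have "\<dots> = (\<Sum>i\<in>I. \<Sum>k<n. \<Sum>j\<in>I. v k i * X i j * v k j)"
    by (intro sum.cong refl sum.swap)
  also have "\<dots> = (\<Sum>k<n. qform I X (v k))"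
    by (rule sum.swap)
  finally show ?thesis using psd_on_qform[OF assms(3)] by (simp add: sum_nonneg)
qed

text \<open>Tychonoff. Coordinates outside \<open>S\<close> are pinned to 0 because the index type
  may be infinite while the matrices live on a finite part of it.\<close>

lemma compact_box:
  "compact {X :: 'a \<Rightarrow> real. \<forall>p. X p \<in> (if p \<in> S then {-R..R} else {0})}"
proof -
  have "compactin (product_topology (\<lambda>_::'a. euclideanreal) UNIV)
      (PiE UNIV (\<lambda>p. if p \<in> S then {-R..R} else {0}))"
    by (subst compactin_PiE) auto
  then show ?thesis
    by (simp add: euclidean_product_topology PiE_UNIV_domain Pi_def)
qed

text \<open>The shift \<open>c\<close> is 0 for \<open>Z\<close> itself and 1 for
  \<open>Z - J\<close>.\<close>

lemma closed_psd_on: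
  "closed {X :: 'i \<times> 'i \<Rightarrow> real. psd_on I (\<lambda>i j. X (i, j) - c)}"
proof -
  have "{X :: 'i \<times> 'i \<Rightarrow> real. psd_on I (\<lambda>i j. X (i, j) - c)} =
     (\<Inter>i\<in>I. \<Inter>j\<in>I. {X. X (i, j) - c = X (j, i) - c}) \<inter>
     (\<Inter>x. {X. 0 \<le> qform I (\<lambda>i j. X (i, j) - c) x})"
    by (auto simp: psd_on_def symmetric_on_def)
  also have "closed \<dots>"
    by (intro closed_Int closed_INT ballI closed_Collect_le closed_Collect_eq continuous_intros
        continuous_on_product_coordinates)
  finally show ?thesis .
qed


subsection \<open>A theorem of the alternative for doubly nonnegative matrices\<close>

lemma first_order_nonneg:
  fixes a c :: real
  assumes "\<And>s. 0 < s \<Longrightarrow> s \<le> 1 \<Longrightarrow> 0 \<le> s * a + s^2 * c"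
  shows "0 \<le> a"
proof (rule ccontr)
  assume "\<not> 0 \<le> a"
  \<comment> \<open>Small enough that \<open>s * c\<close> is at most \<open>- a / 2\<close>, so the
    linear term wins.\<close>
  define s where "s = min 1 (- a / (2 * (\<bar>c\<bar> + 1)))"
  have s: "0 < s" "s \<le> 1" using \<open>\<not> 0 \<le> a\<close> by (auto simp: s_def divide_neg_pos)
  have "s * c \<le> s * (\<bar>c\<bar> + 1)" using s by (intro mult_left_mono) auto
  also have "\<dots> \<le> - a / (2 * (\<bar>c\<bar> + 1)) * (\<bar>c\<bar> + 1)"
    by (intro mult_right_mono) (auto simp: s_def)
  also have "\<dots> = - a / 2"
  proof -
    have "\<bar>c\<bar> + 1 \<noteq> 0" by linarith
    then show ?thesis by (simp only: times_divide_eq_left) (simp add: divide_simps)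
  qed
  finally have "a + s * c < 0" using \<open>\<not> 0 \<le> a\<close> by simp
  then have "s * (a + s * c) < 0" using s by (simp add: mult_pos_neg)
  then show False using assms[OF s] by (simp add: power2_eq_square algebra_simps)
qed

lemma sum_sum_single:
  assumes "finite I" "r \<in> I"
  shows "(\<Sum>i\<in>I. \<Sum>j\<in>I. if i = r \<and> j = r then g i j else 0) = g r r"
proof -
  have "(\<Sum>j\<in>I. if i = r \<and> j = r then g i j else 0) = (if i = r then g r r else 0)" for i
    using assms by (cases "i = r") simp_all
  then show ?thesis using assms by simp
qed

text \<open>Half the squared distance to the nonnegative half-line has a 1-Lipschitz derivative.\<close>

lemma min_zero_square_le:
  fixes x h :: real
  shows "(min (x + h) 0)^2 / 2 \<le> (min x 0)^2 / 2 + h * min x 0 + h^2 / 2"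
proof -
  have "(min (x + h) 0)^2 \<le> (min x 0 + h)^2"
    by (rule abs_le_square_iff[THEN iffD1]) (auto simp: min_def)
  then show ?thesis by (simp add: power2_eq_square algebra_simps)
qed

text \<open>The certificate is the gradient, at a minimiser \<open>X\<close> over the cone of positive semidefinite
  matrices, of the penalty function
  \<open>(X\<^sub>r\<^sub>r - 1)\<^sup>2 / 2 + \<langle>A, X\<rangle> + (\<Sum>P. X\<^sub>i\<^sub>j\<^sup>2) / 2 + (\<Sum>(min X\<^sub>i\<^sub>j 0)\<^sup>2) / 2\<close>.
  This way no closedness of a sum of cones is needed.\<close>

lemma dnn_alternative:
  fixes A :: "'i mat" and P :: "'i \<Rightarrow> 'i \<Rightarrow> bool"
  assumes fin: "finite I" and r: "r \<in> I" and A: "psd_on I A"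
    and P: "\<And>i j. P i j \<longleftrightarrow> P j i"
    and bound: "\<And>X. psd_on I X \<Longrightarrow> X r r \<le> 2 \<Longrightarrow> mat_inner I A X \<le> 1 \<Longrightarrow>
        (\<And>i j. i \<in> I \<Longrightarrow> j \<in> I \<Longrightarrow> P i j \<Longrightarrow> \<bar>X i j\<bar> \<le> 1) \<Longrightarrow> \<forall>i\<in>I. X i i \<le> R"
    and infeasible: "\<not> (\<exists>X. dnn_on I X \<and> X r r = 1 \<and> mat_inner I A X = 0
        \<and> (\<forall>i\<in>I. \<forall>j\<in>I. P i j \<longrightarrow> X i j = 0))"
  shows "\<exists>s Y N. 0 < s \<and> symmetric_on I Y \<and> (\<forall>i\<in>I. \<forall>j\<in>I. \<not> P i j \<longrightarrow> Y i j = 0)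
    \<and> symmetric_on I N \<and> (\<forall>i\<in>I. \<forall>j\<in>I. 0 \<le> N i j)
    \<and> psd_on I (\<lambda>i j. A i j - (if i = r \<and> j = r then s else 0) + Y i j - N i j)"
proof -
  define \<phi> where "\<phi> i j x = (if i = r \<and> j = r then (x - 1)^2 / 2 else 0) + A i j * x
    + (if P i j then x^2 / 2 else 0) + (min x 0)^2 / 2" for i j and x :: real
  define \<phi>' where "\<phi>' i j x = (if i = r \<and> j = r then x - 1 else 0) + A i j
    + (if P i j then x else 0) + min x 0" for i j and x :: real
  define F where "F X = (\<Sum>i\<in>I. \<Sum>j\<in>I. \<phi> i j (X i j))" for X :: "'i mat"
  have F_split: "F X = (X r r - 1)^2 / 2 + mat_inner I A X
      + (\<Sum>i\<in>I. \<Sum>j\<in>I. if P i j then (X i j)^2 / 2 else 0)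
      + (\<Sum>i\<in>I. \<Sum>j\<in>I. (min (X i j) 0)^2 / 2)" for X
    unfolding F_def \<phi>_def mat_inner_def
    using sum_sum_single[OF fin r, of "\<lambda>i j. (X i j - 1)^2 / 2"] by (simp add: sum.distrib)
  have F0: "F (\<lambda>_ _. 0) = 1 / 2"
    unfolding F_split by (simp add: mat_inner_def cong: if_cong)
  \<comment> \<open>\<open>X = 0\<close> has penalty \<open>1 / 2\<close>, so only this sublevel set
    matters. All summands of \<open>F\<close> are nonnegative there, which produces the thresholds
    2, 1 and 1 in \<open>bound\<close>.\<close>
  have F_bound: "\<forall>i\<in>I. X i i \<le> R" if X: "psd_on I X" and le: "F X \<le> 1 / 2" for X
  proof (rule bound[OF X])
    have nn: "0 \<le> mat_inner I A X" by (rule mat_inner_psd_nonneg[OF fin A X])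
    have nnP: "0 \<le> (\<Sum>i\<in>I. \<Sum>j\<in>I. if P i j then (X i j)^2 / 2 else 0)"
      by (intro sum_nonneg) auto
    have nnm: "0 \<le> (\<Sum>i\<in>I. \<Sum>j\<in>I. (min (X i j) 0)^2 / 2)"
      by (intro sum_nonneg) auto
    have sq: "0 \<le> (X r r - 1)^2" by simp
    show "mat_inner I A X \<le> 1"
      using le nnP nnm sq unfolding F_split by linarith
    have "(X r r - 1)^2 \<le> 1^2"
      using le nn nnP nnm unfolding F_split by simp
    then have "\<bar>X r r - 1\<bar> \<le> 1" by (simp only: power2_le_iff_abs_le abs_one zero_le_one)
    then show "X r r \<le> 2" by simp
    fix i j assume ij: "i \<in> I" "j \<in> I" "P i j"
    have "(X i j)^2 / 2 \<le> (\<Sum>j\<in>I. if P i j then (X i j)^2 / 2 else 0)"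
      using member_le_sum[OF ij(2), of "\<lambda>j. if P i j then (X i j)^2 / 2 else 0"] fin ij(3) by simp
    also have "\<dots> \<le> (\<Sum>i\<in>I. \<Sum>j\<in>I. if P i j then (X i j)^2 / 2 else 0)"
      by (rule member_le_sum[OF ij(1)]) (auto intro!: sum_nonneg fin)
    also have "\<dots> \<le> 1 / 2" using le nn nnm sq unfolding F_split by linarith
    finally have "(X i j)^2 \<le> 1^2" by simp
    then show "\<bar>X i j\<bar> \<le> 1" by (simp only: power2_le_iff_abs_le abs_one zero_le_one)
  qed
  define K where "K = {X :: 'i \<times> 'i \<Rightarrow> real. \<forall>p. X p \<in> (if p \<in> I \<times> I then {-R..R} else {0})}
    \<inter> {X. psd_on I (\<lambda>i j. X (i, j) - 0)}"
  \<comment> \<open>Neither \<open>F\<close> nor \<open>psd_on I\<close> sees entries outside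
    \<open>I \<times> I\<close>, so they may be set to 0 to land in the compact set.\<close>
  have trunc: "(\<lambda>p. if p \<in> I \<times> I then X (fst p) (snd p) else 0) \<in> K"
    if X: "psd_on I X" and le: "F X \<le> 1 / 2" for X
  proof -
    have "psd_on I (\<lambda>i j. (if (i, j) \<in> I \<times> I then X (fst (i, j)) (snd (i, j)) else 0) - 0)"
      using X by (subst psd_on_cong[of I _ X]) auto
    moreover have "\<bar>X i j\<bar> \<le> R" if "i \<in> I" "j \<in> I" for i j
      using psd_on_abs_le[OF fin X that] F_bound[OF X le] that by blast
    ultimately show ?thesis unfolding K_def by (auto simp: abs_le_iff minus_le_iff)
  qed
  have "compact K"
    unfolding K_def by (intro compact_Int_closed compact_box closed_psd_on)
  moreover have "K \<noteq> {}"
    using trunc[of "\<lambda>_ _. 0"] F0 by (auto simp: psd_on_def symmetric_on_def)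
  moreover have "continuous_on K (\<lambda>X. F (\<lambda>i j. X (i, j)))"
  proof -
    have "continuous_on K (\<lambda>X. \<phi> i j (X (i, j)))" for i j
      unfolding \<phi>_def
      by (cases "i = r \<and> j = r"; cases "P i j")
        (auto intro!: continuous_intros continuous_on_subset[OF continuous_on_product_coordinates])
    then show ?thesis unfolding F_def by (intro continuous_on_sum)
  qed
  ultimately obtain X' where X': "X' \<in> K"
    and min': "\<And>X. X \<in> K \<Longrightarrow> F (\<lambda>i j. X' (i, j)) \<le> F (\<lambda>i j. X (i, j))"
    using continuous_attains_inf by metis
  define X where "X = (\<lambda>i j. X' (i, j))"
  have X: "psd_on I X" using X' by (simp add: K_def X_def)
  have min: "F X \<le> F W" if W: "psd_on I W" for W
  proof (cases "F W \<le> 1 / 2")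
    case True
    have "F X \<le> F (\<lambda>i j. if (i, j) \<in> I \<times> I then W i j else 0)"
      using min'[OF trunc[OF W True]] by (simp add: X_def cong: if_cong)
    also have "\<dots> = F W" by (simp add: F_def)
    finally show ?thesis .
  next
    case False
    have "psd_on I (\<lambda>_ _. 0)" by (simp add: psd_on_def symmetric_on_def)
    from min'[OF trunc[OF this]] have "F X \<le> 1 / 2" using F0 by (simp add: X_def)
    then show ?thesis using False by simp
  qed
  define G where "G i j = \<phi>' i j (X i j)" for i j
  \<comment> \<open>The three quadratic pieces of \<open>\<phi>\<close> contribute at most
    \<open>h^2 / 2\<close> each, whence \<open>3 / 2\<close>.\<close>
  have step: "\<phi> i j (x + h) \<le> \<phi> i j x + h * \<phi>' i j x + h^2 * (3 / 2)" for i j x h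
  proof -
    have "\<phi> i j (x + h) - (min (x + h) 0)^2 / 2
        \<le> \<phi> i j x - (min x 0)^2 / 2 + h * (\<phi>' i j x - min x 0) + h^2"
      unfolding \<phi>_def \<phi>'_def by (simp add: power2_eq_square field_simps)
    with min_zero_square_le[of x h] show ?thesis by (simp add: algebra_simps)
  qed
  \<comment> \<open>First-order optimality along directions that stay in the cone. It is applied to
    \<open>x x^T\<close>, which makes \<open>G\<close> positive semidefinite, and to
    \<open>- X\<close>, which bounds the pairing of \<open>G\<close> with \<open>X\<close> by
    0.\<close>
  have grad: "0 \<le> mat_inner I G D"
    if D: "\<And>s. 0 < s \<Longrightarrow> s \<le> 1 \<Longrightarrow> psd_on I (\<lambda>i j. X i j + s * D i j)" for D
  proof (rule first_order_nonneg)
    fix s :: real assume s: "0 < s" "s \<le> 1"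
    have "F X \<le> F (\<lambda>i j. X i j + s * D i j)" by (rule min[OF D[OF s]])
    also have "\<dots> \<le> (\<Sum>i\<in>I. \<Sum>j\<in>I. \<phi> i j (X i j) + (s * D i j) * G i j + (s * D i j)^2 * (3 / 2))"
      unfolding F_def G_def by (intro sum_mono step)
    also have "\<dots> = F X + s * mat_inner I G D + s^2 * (\<Sum>i\<in>I. \<Sum>j\<in>I. (D i j)^2 * (3 / 2))"
      unfolding F_def mat_inner_def
      by (simp add: sum.distrib sum_distrib_left power_mult_distrib algebra_simps)
    finally show "0 \<le> s * mat_inner I G D + s^2 * (\<Sum>i\<in>I. \<Sum>j\<in>I. (D i j)^2 * (3 / 2))" by simp
  qed
  have symX: "X i j = X j i" if "i \<in> I" "j \<in> I" for i j
    using psd_on_sym[OF X that] .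
  have G: "psd_on I G"
  proof (rule psd_onI)
    show "symmetric_on I G"
      unfolding symmetric_on_def
    proof (intro ballI)
      fix i j assume ij: "i \<in> I" "j \<in> I"
      show "G i j = G j i"
        unfolding G_def \<phi>'_def using symX[OF ij] psd_on_sym[OF A ij] P[of i j] by auto
    qed
    fix x
    have "0 \<le> mat_inner I G (\<lambda>i j. x i * x j)"
      by (rule grad) (intro psd_on_add X psd_on_scale psd_on_outer, simp)
    then show "0 \<le> qform I G x" by (simp add: mat_inner_def algebra_simps)
  qed
  \<comment> \<open>If \<open>X r r\<close> were at least 1, the pairing of \<open>G\<close> with
    \<open>X\<close> would be a sum of four nonnegative terms that is at most 0. All of them vanish,
    and \<open>X\<close> is the excluded solution.\<close>
  have less: "X r r < 1"
  proof (rule ccontr)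
    assume "\<not> X r r < 1"
    have "0 \<le> mat_inner I G (\<lambda>i j. - X i j)"
    proof (rule grad)
      fix s :: real assume "0 < s" "s \<le> 1"
      then show "psd_on I (\<lambda>i j. X i j + s * - X i j)"
        using psd_on_scale[OF X, of "1 - s"] by (simp add: algebra_simps)
    qed
    then have "mat_inner I G X \<le> 0"
      by (simp add: mat_inner_def sum_negf)
    moreover have "G i j * X i j = (if i = r \<and> j = r then (X i j - 1) * X i j else 0) + A i j * X i j
        + (if P i j then (X i j)^2 else 0) + (min (X i j) 0)^2" for i j
      by (auto simp: G_def \<phi>'_def power2_eq_square algebra_simps min_def)
    then have "mat_inner I G X = (X r r - 1) * X r r + mat_inner I A X
        + (\<Sum>i\<in>I. \<Sum>j\<in>I. if P i j then (X i j)^2 else 0) + (\<Sum>i\<in>I. \<Sum>j\<in>I. (min (X i j) 0)^2)"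
      unfolding mat_inner_def
      using sum_sum_single[OF fin r, of "\<lambda>i j. (X i j - 1) * X i j"] by (simp add: sum.distrib)
    moreover have "0 \<le> mat_inner I A X" by (rule mat_inner_psd_nonneg[OF fin A X])
    moreover have "0 \<le> (X r r - 1) * X r r" using \<open>\<not> X r r < 1\<close> by simp
    moreover have "0 \<le> (\<Sum>i\<in>I. \<Sum>j\<in>I. if P i j then (X i j)^2 else 0)"
      by (intro sum_nonneg) auto
    moreover have "0 \<le> (\<Sum>i\<in>I. \<Sum>j\<in>I. (min (X i j) 0)^2)"
      by (intro sum_nonneg) auto
    ultimately have z: "(X r r - 1) * X r r = 0" "mat_inner I A X = 0"
      "(\<Sum>i\<in>I. \<Sum>j\<in>I. if P i j then (X i j)^2 else 0) = 0"
      "(\<Sum>i\<in>I. \<Sum>j\<in>I. (min (X i j) 0)^2) = 0"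
      by linarith+
    have "X r r = 1" using z(1) \<open>\<not> X r r < 1\<close> by auto
    moreover have "X i j = 0" if "i \<in> I" "j \<in> I" "P i j" for i j
    proof -
      have "(\<Sum>j\<in>I. if P i j then (X i j)^2 else 0) = 0"
        using z(3) that(1) by (subst (asm) sum_nonneg_eq_0_iff) (auto intro!: sum_nonneg fin)
      then have "(if P i j then (X i j)^2 else 0) = 0"
        using that(2) by (subst (asm) sum_nonneg_eq_0_iff) (auto intro!: fin)
      then show ?thesis using that(3) by simp
    qed
    moreover have "0 \<le> X i j" if "i \<in> I" "j \<in> I" for i j
    proof -
      have "(\<Sum>j\<in>I. (min (X i j) 0)^2) = 0"
        using z(4) that(1) by (subst (asm) sum_nonneg_eq_0_iff) (auto intro!: sum_nonneg fin)
      then have "(min (X i j) 0)^2 = 0"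
        using that(2) by (subst (asm) sum_nonneg_eq_0_iff) (auto intro!: fin)
      then show ?thesis by simp
    qed
    ultimately show False
      using infeasible X z(2) unfolding dnn_on_def by blast
  qed
  \<comment> \<open>The certificate is read off the gradient: \<open>s\<close> is the gap
    \<open>1 - X r r\<close>, \<open>Y\<close> is \<open>X\<close> on the pattern and
    \<open>N\<close> is the negative part of \<open>X\<close>.\<close>
  have "(\<lambda>i j. A i j - (if i = r \<and> j = r then 1 - X r r else 0)
      + (if P i j then X i j else 0) - - min (X i j) 0) = G"
    by (auto simp: G_def \<phi>'_def fun_eq_iff)
  with G have "psd_on I (\<lambda>i j. A i j - (if i = r \<and> j = r then 1 - X r r else 0)
      + (if P i j then X i j else 0) - - min (X i j) 0)"
    by (simp only:)
  moreover have "symmetric_on I (\<lambda>i j. if P i j then X i j else 0)"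
    "symmetric_on I (\<lambda>i j. - min (X i j) 0)"
    unfolding symmetric_on_def using P symX by (metis (full_types))+
  ultimately show ?thesis
    using less by (intro exI[of _ "1 - X r r"] exI[of _ "\<lambda>i j. if P i j then X i j else 0"]
      exI[of _ "\<lambda>i j. - min (X i j) 0"]) auto
qed


subsection \<open>Membership in the tracial quadratic module\<close>

lemma poly_mapping_eq_sum_single:
  fixes p :: "'a \<Rightarrow>\<^sub>0 'b::comm_monoid_add"
  shows "p = (\<Sum>v\<in>Poly_Mapping.keys p. Poly_Mapping.single v (Poly_Mapping.lookup p v))"
proof (rule poly_mapping_eqI)
  fix w
  show "Poly_Mapping.lookup p w = Poly_Mapping.lookup
      (\<Sum>v\<in>Poly_Mapping.keys p. Poly_Mapping.single v (Poly_Mapping.lookup p v)) w"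
    by (simp add: lookup_sum lookup_single when_def in_keys_iff)
qed

lemma nc_star_zero [simp]: "nc_star 0 = 0"
  by (rule poly_mapping_eqI) (simp add: lookup_nc_star)

lemma nc_star_add: "nc_star (f + g) = nc_star f + nc_star g"
  by (rule poly_mapping_eqI) (simp add: lookup_nc_star lookup_add)

lemma nc_star_sum: "nc_star (\<Sum>i\<in>I. f i) = (\<Sum>i\<in>I. nc_star (f i))"
  using sum_comp_morphism[of nc_star f I] by (simp add: nc_star_add o_def)

lemma keys_nc_star: "Poly_Mapping.keys (nc_star f) = monomial_rev ` Poly_Mapping.keys f"
  by (force simp: in_keys_iff lookup_nc_star image_iff intro: monomial_rev_rev[symmetric])

lemma nc_var_squares:
  "nc_var i ^ 2 * nc_var j ^ 2 = Poly_Mapping.single (Monomial [i, i, j, j]) 1"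
  by (simp add: nc_var_def power2_eq_square mult_single plus_monomial_def)

lemma mat_poly_single:
  "mat_poly I M = (\<Sum>i\<in>I. \<Sum>j\<in>I. Poly_Mapping.single (Monomial [i, i, j, j]) (M i j))"
  by (simp add: mat_poly_def nc_var_squares nc_const_def mult_single)

lemma nc_polys_single: "set ws \<subseteq> I \<Longrightarrow> Poly_Mapping.single (Monomial ws) c \<in> nc_polys I"
  by (simp add: nc_polys_def)

lemma nc_polys_zero: "0 \<in> nc_polys I"
  by (simp add: nc_polys_def)

lemma nc_polys_add: "f \<in> nc_polys I \<Longrightarrow> g \<in> nc_polys I \<Longrightarrow> f + g \<in> nc_polys I"
  using keys_add[of f g] by (auto simp: nc_polys_def)

lemma nc_polys_sum: "(\<And>a. a \<in> A \<Longrightarrow> f a \<in> nc_polys I) \<Longrightarrow> (\<Sum>a\<in>A. f a) \<in> nc_polys I"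
  by (induction A rule: infinite_finite_induct) (auto intro: nc_polys_add nc_polys_zero)

lemma tr_qmodule_ball_zero: "0 \<in> tr_qmodule_ball I"
  unfolding tr_qmodule_ball_def by (auto intro!: exI[of _ "[]"])

lemma tr_qmodule_ball_add:
  assumes "p \<in> tr_qmodule_ball I" "q \<in> tr_qmodule_ball I"
  shows "p + q \<in> tr_qmodule_ball I"
proof -
  from assms obtain cs fs gs cs' fs' gs' where
    "set cs \<subseteq> nc_polys I \<times> nc_polys I" "set fs \<subseteq> nc_polys I" "set gs \<subseteq> nc_polys I"
    "p = (\<Sum>(f, g) \<leftarrow> cs. f * g - g * f) + (\<Sum>f \<leftarrow> fs. f * nc_star f)
         + (\<Sum>g \<leftarrow> gs. g * (1 - (\<Sum>i\<in>I. nc_var i ^ 2)) * nc_star g)"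
    "set cs' \<subseteq> nc_polys I \<times> nc_polys I" "set fs' \<subseteq> nc_polys I" "set gs' \<subseteq> nc_polys I"
    "q = (\<Sum>(f, g) \<leftarrow> cs'. f * g - g * f) + (\<Sum>f \<leftarrow> fs'. f * nc_star f)
         + (\<Sum>g \<leftarrow> gs'. g * (1 - (\<Sum>i\<in>I. nc_var i ^ 2)) * nc_star g)"
    unfolding tr_qmodule_ball_def by blast
  then show ?thesis
    unfolding tr_qmodule_ball_def
    by (intro CollectI exI[of _ "cs @ cs'"] exI[of _ "fs @ fs'"] exI[of _ "gs @ gs'"])
      (simp add: add_ac)
qed

lemma tr_qmodule_ball_sum:
  "(\<And>a. a \<in> A \<Longrightarrow> f a \<in> tr_qmodule_ball I) \<Longrightarrow> (\<Sum>a\<in>A. f a) \<in> tr_qmodule_ball I"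
  by (induction A rule: infinite_finite_induct) (auto intro: tr_qmodule_ball_add tr_qmodule_ball_zero)

lemma tr_qmodule_ball_commutator:
  "f \<in> nc_polys I \<Longrightarrow> g \<in> nc_polys I \<Longrightarrow> f * g - g * f \<in> tr_qmodule_ball I"
  unfolding tr_qmodule_ball_def
  by (intro CollectI exI[of _ "[(f, g)]"] exI[of _ "[]"]) simp

lemma tr_qmodule_ball_square: "f \<in> nc_polys I \<Longrightarrow> f * nc_star f \<in> tr_qmodule_ball I"
  unfolding tr_qmodule_ball_def
  by (rule CollectI, rule exI[of _ "[]"], rule exI[of _ "[f]"], rule exI[of _ "[]"]) simp

text \<open>\<open>X\<^sub>i\<^sup>2 X\<^sub>j\<^sup>2\<close> differs from the square \<open>(X\<^sub>i X\<^sub>j) (X\<^sub>i X\<^sub>j)\<^sup>*\<close> by a commutator.\<close>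

lemma tr_qmodule_ball_nonneg:
  assumes "i \<in> I" "j \<in> I" "0 \<le> c"
  shows "Poly_Mapping.single (Monomial [i, i, j, j]) c \<in> tr_qmodule_ball I"
proof -
  let ?f = "Poly_Mapping.single (Monomial [i]) c"
  let ?g = "Poly_Mapping.single (Monomial [i, j, j]) 1"
  let ?h = "Poly_Mapping.single (Monomial [i, j]) (sqrt c)"
  have "Poly_Mapping.single (Monomial [i, i, j, j]) c = (?f * ?g - ?g * ?f) + ?h * nc_star ?h"
    using assms(3) by (simp add: nc_star_single mult_single plus_monomial_def)
  also have "\<dots> \<in> tr_qmodule_ball I"
    using assms(1,2) by (intro tr_qmodule_ball_add tr_qmodule_ball_commutator
        tr_qmodule_ball_square nc_polys_single) auto
  finally show ?thesis .
qed

text \<open>A Gram vector \<open>v\<close> of the semidefinite part gives the square of the sum of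
  the \<open>v i X_i^2\<close>; the entries of \<open>N\<close> are handled one by one, and
  \<open>\<epsilon>\<close> is the square of a constant.\<close>

lemma K_nc_psd_plus_nonneg:
  fixes I :: "'i set"
  assumes "finite I" "symmetric_on I M" "psd_on I (\<lambda>i j. M i j - N i j)"
    and "\<And>i j. i \<in> I \<Longrightarrow> j \<in> I \<Longrightarrow> 0 \<le> N i j" and "0 \<le> \<epsilon>"
  shows "M \<in> K_nc \<epsilon> I"
proof -
  from psd_on_gram[OF assms(1,3)] obtain n v
    where v: "\<And>i j. i \<in> I \<Longrightarrow> j \<in> I \<Longrightarrow> M i j - N i j = (\<Sum>k<(n::nat). v k i * v k j)" by blast
  define f where "f k = (\<Sum>i\<in>I. Poly_Mapping.single (Monomial [i, i]) (v k i))" for k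
  let ?m = "\<lambda>i j. Poly_Mapping.single (Monomial [i, i, j, j])"
  have f: "f k \<in> nc_polys I" for k
    unfolding f_def by (intro nc_polys_sum nc_polys_single) auto
  have "f k * nc_star (f k) = (\<Sum>i\<in>I. \<Sum>j\<in>I. ?m i j (v k i * v k j))" for k
    by (simp add: f_def nc_star_sum nc_star_single sum_product mult_single plus_monomial_def)
  then have "(\<Sum>k<n. f k * nc_star (f k)) = (\<Sum>k<n. \<Sum>i\<in>I. \<Sum>j\<in>I. ?m i j (v k i * v k j))"
    by simp
  also have "\<dots> = (\<Sum>i\<in>I. \<Sum>k<n. \<Sum>j\<in>I. ?m i j (v k i * v k j))" by (rule sum.swap)
  also have "\<dots> = (\<Sum>i\<in>I. \<Sum>j\<in>I. \<Sum>k<n. ?m i j (v k i * v k j))"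
    by (intro sum.cong refl sum.swap)
  also have "\<dots> = (\<Sum>i\<in>I. \<Sum>j\<in>I. ?m i j (M i j - N i j))"
  proof (intro sum.cong refl)
    fix i j assume "i \<in> I" "j \<in> I"
    then show "(\<Sum>k<n. ?m i j (v k i * v k j)) = ?m i j (M i j - N i j)"
      using sum_comp_morphism[of "?m i j" "\<lambda>k. v k i * v k j" "{..<n}"]
      by (simp add: v single_add o_def)
  qed
  finally have "mat_poly I M = (\<Sum>k<n. f k * nc_star (f k)) + (\<Sum>i\<in>I. \<Sum>j\<in>I. ?m i j (N i j))"
    by (simp add: mat_poly_single sum.distrib[symmetric] single_add[symmetric])
  moreover have "(nc_const \<epsilon> :: 'i ncpoly) = Poly_Mapping.single (Monomial []) (sqrt \<epsilon>)
      * nc_star (Poly_Mapping.single (Monomial []) (sqrt \<epsilon>))"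
    using assms(5) by (simp add: nc_const_def nc_star_single mult_single plus_monomial_def
        zero_monomial_def)
  then have "(nc_const \<epsilon> :: 'i ncpoly) \<in> tr_qmodule_ball I"
    using tr_qmodule_ball_square[OF nc_polys_single[of "[]" I "sqrt \<epsilon>"]] by simp
  ultimately have "mat_poly I M + nc_const \<epsilon> \<in> tr_qmodule_ball I"
    using assms(4) f
    by (auto intro!: tr_qmodule_ball_add tr_qmodule_ball_sum tr_qmodule_ball_square
        tr_qmodule_ball_nonneg)
  then show ?thesis using assms(2) by (simp add: K_nc_def)
qed


subsection \<open>Linear functionals on non-commutative polynomials\<close>

definition word_eval :: "('i list \<Rightarrow> real) \<Rightarrow> 'i ncpoly \<Rightarrow> real" where
  "word_eval L p = (\<Sum>w\<in>Poly_Mapping.keys p. Poly_Mapping.lookup p w * L (letters w))"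

lemma word_eval_superset:
  assumes "finite K" "Poly_Mapping.keys p \<subseteq> K"
  shows "word_eval L p = (\<Sum>w\<in>K. Poly_Mapping.lookup p w * L (letters w))"
  unfolding word_eval_def using assms
  by (intro sum.mono_neutral_left) (auto simp: in_keys_iff)

lemma word_eval_zero [simp]: "word_eval L 0 = 0"
  by (simp add: word_eval_def)

lemma word_eval_add: "word_eval L (p + q) = word_eval L p + word_eval L q"
proof -
  let ?K = "Poly_Mapping.keys p \<union> Poly_Mapping.keys q"
  show ?thesis
    using keys_add[of p q]
    by (simp add: word_eval_superset[of ?K] lookup_add sum.distrib algebra_simps)
qed

lemma word_eval_diff: "word_eval L (p - q) = word_eval L p - word_eval L q"
  using word_eval_add[of L "p - q" q] by simp

lemma word_eval_sum: "word_eval L (\<Sum>a\<in>A. f a) = (\<Sum>a\<in>A. word_eval L (f a))"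
  using sum_comp_morphism[of "word_eval L" f A] by (simp add: word_eval_add o_def)

lemma word_eval_sum_list: "word_eval L (\<Sum>a\<leftarrow>as. f a) = (\<Sum>a\<leftarrow>as. word_eval L (f a))"
  by (induction as) (simp_all add: word_eval_add)

lemma word_eval_single [simp]: "word_eval L (Poly_Mapping.single w c) = c * L (letters w)"
  by (simp add: word_eval_def)

lemma word_eval_mult:
  "word_eval L (p * q) = (\<Sum>v\<in>Poly_Mapping.keys p. \<Sum>w\<in>Poly_Mapping.keys q.
     Poly_Mapping.lookup p v * Poly_Mapping.lookup q w * L (letters v @ letters w))"
proof -
  have "p * q = (\<Sum>v\<in>Poly_Mapping.keys p. Poly_Mapping.single v (Poly_Mapping.lookup p v))
      * (\<Sum>w\<in>Poly_Mapping.keys q. Poly_Mapping.single w (Poly_Mapping.lookup q w))"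
    using poly_mapping_eq_sum_single[of p] poly_mapping_eq_sum_single[of q] by metis
  then show ?thesis
    by (simp add: sum_product mult_single word_eval_sum plus_monomial_def)
qed

lemma word_eval_mult_star:
  "word_eval L (f * nc_star g) = (\<Sum>v\<in>Poly_Mapping.keys f. Poly_Mapping.lookup f v
     * (\<Sum>w\<in>Poly_Mapping.keys g. Poly_Mapping.lookup g w * L (letters v @ rev (letters w))))"
proof -
  have "inj_on monomial_rev (Poly_Mapping.keys g)"
    using inj_monomial_rev inj_on_subset by blast
  then show ?thesis
    by (simp add: word_eval_mult keys_nc_star sum.reindex lookup_nc_star sum_distrib_left
        mult.assoc monomial_rev_def[THEN arg_cong, of letters])
qed

text \<open>Rotation by one letter iterates to \<open>L (u @ v) = L (v @ u)\<close>, so the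
  functional is tracial.\<close>

lemma word_eval_commutator:
  assumes "\<And>a u. L (a # u) = L (u @ [a])"
  shows "word_eval L (f * g - g * f) = 0"
proof -
  have cyc: "L (u @ v) = L (v @ u)" for u v
  proof (induction u arbitrary: v)
    case (Cons a u)
    have "L ((a # u) @ v) = L (u @ (v @ [a]))" using assms[of a "u @ v"] by simp
    also have "\<dots> = L ((v @ [a]) @ u)" by (rule Cons)
    finally show ?case by simp
  qed simp
  have "word_eval L (f * g) = (\<Sum>w\<in>Poly_Mapping.keys g. \<Sum>v\<in>Poly_Mapping.keys f.
     Poly_Mapping.lookup f v * Poly_Mapping.lookup g w * L (letters v @ letters w))"
    unfolding word_eval_mult by (rule sum.swap)
  also have "\<dots> = word_eval L (g * f)"
    unfolding word_eval_mult
  proof (intro sum.cong refl)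
    fix v w
    show "Poly_Mapping.lookup f v * Poly_Mapping.lookup g w * L (letters v @ letters w)
      = Poly_Mapping.lookup g w * Poly_Mapping.lookup f v * L (letters w @ letters v)"
      using cyc[of "letters v" "letters w"] by simp
  qed
  finally show ?thesis by (simp add: word_eval_diff)
qed

section \<open>Stripping the low-degree terms of a certificate\<close>

definition min_degree :: "nat \<Rightarrow> 'i ncpoly \<Rightarrow> bool" where
  "min_degree k f \<longleftrightarrow> (\<forall>w\<in>Poly_Mapping.keys f. k \<le> length (letters w))"

lemma min_degree_zero: "min_degree 0 f"
  by (simp add: min_degree_def)

lemma min_degree_mult:
  assumes "min_degree k f" "min_degree l g"
  shows "min_degree (k + l) (f * g)"
  using assms keys_mult[of f g] by (fastforce simp: min_degree_def plus_monomial_def)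

lemma min_degree_star: "min_degree k f \<Longrightarrow> min_degree k (nc_star f)"
  by (simp add: min_degree_def keys_nc_star monomial_rev_def)

lemma word_eval_min_degree:
  assumes "min_degree l p" "\<And>w. L w \<noteq> 0 \<Longrightarrow> length w < l"
  shows "word_eval L p = 0"
  unfolding word_eval_def
proof (rule sum.neutral, rule ballI)
  fix w assume "w \<in> Poly_Mapping.keys p"
  then have "L (letters w) = 0"
    using assms by (auto simp: min_degree_def not_less[symmetric])
  then show "Poly_Mapping.lookup p w * L (letters w) = 0" by simp
qed

text \<open>Each \<open>g X_i^2 g*\<close> starts in degree \<open>2 * k + 2\<close>, beyond the
  single degree \<open>2 * k\<close> on which \<open>L\<close> lives.\<close>

lemma word_eval_localizer:
  assumes L: "\<And>w. L w \<noteq> 0 \<Longrightarrow> length w = 2 * k" and g: "min_degree k g"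
  shows "word_eval L (g * (1 - (\<Sum>i\<in>I. nc_var i ^ 2)) * nc_star g) = word_eval L (g * nc_star g)"
proof -
  have "g * (1 - (\<Sum>i\<in>I. nc_var i ^ 2)) * nc_star g
      = g * nc_star g - (\<Sum>i\<in>I. g * nc_var i ^ 2 * nc_star g)"
    by (simp add: algebra_simps sum_distrib_left sum_distrib_right)
  moreover have "word_eval L (g * nc_var i ^ 2 * nc_star g) = 0" for i
  proof (rule word_eval_min_degree)
    have "min_degree 2 (nc_var i ^ 2)"
      by (simp add: min_degree_def nc_var_def power2_eq_square mult_single plus_monomial_def)
    then show "min_degree (k + 2 + k) (g * nc_var i ^ 2 * nc_star g)"
      by (intro min_degree_mult min_degree_star g)
  qed (use L in fastforce)
  ultimately show ?thesis by (simp add: word_eval_diff word_eval_sum)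
qed

text \<open>Commutators vanish and ball terms become squares, so every certificate is evaluated as a
  plain sum over Hermitian squares.\<close>

lemma word_eval_tr_qmodule:
  assumes cyc: "\<And>a u. L (a # u) = L (u @ [a])" and L: "\<And>w. L w \<noteq> 0 \<Longrightarrow> length w = 2 * k"
    and gs: "\<And>g. g \<in> set gs \<Longrightarrow> min_degree k g"
  shows "word_eval L ((\<Sum>(f, g) \<leftarrow> cs. f * g - g * f) + (\<Sum>f \<leftarrow> fs. f * nc_star f)
         + (\<Sum>g \<leftarrow> gs. g * (1 - (\<Sum>i\<in>I. nc_var i ^ 2)) * nc_star g))
    = (\<Sum>f \<leftarrow> fs @ gs. word_eval L (f * nc_star f))"
proof -
  have "word_eval L (\<Sum>(f, g) \<leftarrow> cs. f * g - g * f) = 0"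
    by (induction cs) (auto simp: word_eval_add word_eval_commutator[OF cyc])
  moreover have "word_eval L (\<Sum>g \<leftarrow> gs. g * (1 - (\<Sum>i\<in>I. nc_var i ^ 2)) * nc_star g)
      = (\<Sum>g \<leftarrow> gs. word_eval L (g * nc_star g))"
    unfolding word_eval_sum_list
    by (intro arg_cong[of _ _ sum_list] map_cong refl word_eval_localizer[OF L] gs)
  ultimately show ?thesis
    by (simp add: word_eval_add word_eval_sum_list)
qed

text \<open>The words of weight 1 are those of the form \<open>v @ rev v\<close> with
  \<open>v\<close> of length \<open>k\<close>. The weight is cyclic for \<open>k \<le> 1\<close>
  only: \<open>abba\<close> rotates to \<open>bbaa\<close>. Degree 4 therefore calls for a different
  functional.\<close>

definition palindrome_weight :: "nat \<Rightarrow> 'i list \<Rightarrow> real" where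
  "palindrome_weight k w = of_bool (length w = 2 * k \<and> rev w = w)"

lemma palindrome_weight_cyclic:
  assumes "k \<le> 1"
  shows "palindrome_weight k (a # u) = palindrome_weight k (u @ [a])"
proof (cases "length u = 1")
  case True
  then obtain b where "u = [b]" by (auto simp: length_Suc_conv)
  then show ?thesis by (cases "a = b") (simp_all add: palindrome_weight_def)
next
  case False
  then have "Suc (length u) \<noteq> 2 * k" using assms by presburger
  then show ?thesis by (simp add: palindrome_weight_def)
qed

text \<open>Both factors of a word \<open>v @ rev w\<close> have length at least \<open>k\<close>;
  total length \<open>2 * k\<close> forces length \<open>k\<close> for both, and the palindrome
  condition then says \<open>v = w\<close>. Only squares of coefficients survive.\<close>

lemma word_eval_palindrome_weight:
  assumes "min_degree k f"
  shows "word_eval (palindrome_weight k) (f * nc_star f)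
    = (\<Sum>v\<in>Poly_Mapping.keys f. of_bool (length (letters v) = k) * (Poly_Mapping.lookup f v)^2)"
  unfolding word_eval_mult_star
proof (rule sum.cong[OF refl])
  fix v assume v: "v \<in> Poly_Mapping.keys f"
  have "palindrome_weight k (letters v @ rev (letters w)) = of_bool (length (letters v) = k \<and> w = v)"
    if w: "w \<in> Poly_Mapping.keys f" for w
  proof -
    have len: "k \<le> length (letters v)" "k \<le> length (letters w)"
      using assms v w by (auto simp: min_degree_def)
    then have "length (letters v) + length (letters w) = 2 * k
        \<longleftrightarrow> length (letters v) = k \<and> length (letters w) = k" by auto
    then show ?thesis
      by (auto simp: palindrome_weight_def append_eq_append_conv intro: monomial.expand)
  qed
  then have "(\<Sum>w\<in>Poly_Mapping.keys f. Poly_Mapping.lookup f w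
        * palindrome_weight k (letters v @ rev (letters w)))
      = (\<Sum>w\<in>Poly_Mapping.keys f. if w = v
          then of_bool (length (letters v) = k) * Poly_Mapping.lookup f v else 0)"
    by (intro sum.cong) auto
  also have "\<dots> = of_bool (length (letters v) = k) * Poly_Mapping.lookup f v"
    using v by simp
  finally show "Poly_Mapping.lookup f v * (\<Sum>w\<in>Poly_Mapping.keys f. Poly_Mapping.lookup f w
        * palindrome_weight k (letters v @ rev (letters w)))
      = of_bool (length (letters v) = k) * (Poly_Mapping.lookup f v)^2"
    by (simp add: power2_eq_square)
qed

text \<open>The squares evaluate to nonnegative numbers with sum 0, so the degree \<open>k\<close>
  coefficients of all \<open>f\<close> and \<open>g\<close> vanish together.\<close>

lemma min_degree_step:
  assumes k: "k \<le> 1" and deg: "\<And>f. f \<in> set (fs @ gs) \<Longrightarrow> min_degree k f"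
    and zero: "word_eval (palindrome_weight k) ((\<Sum>(f, g) \<leftarrow> cs. f * g - g * f)
         + (\<Sum>f \<leftarrow> fs. f * nc_star f)
         + (\<Sum>g \<leftarrow> gs. g * (1 - (\<Sum>i\<in>I. nc_var i ^ 2)) * nc_star g)) = 0"
    and f: "f \<in> set (fs @ gs)"
  shows "min_degree (Suc k) f"
proof -
  let ?L = "palindrome_weight k"
  have S: "word_eval ?L (f * nc_star f) = (\<Sum>v\<in>Poly_Mapping.keys f.
      of_bool (length (letters v) = k) * (Poly_Mapping.lookup f v)^2)" if "f \<in> set (fs @ gs)" for f
    by (rule word_eval_palindrome_weight[OF deg[OF that]])
  have nonneg: "0 \<le> word_eval ?L (f * nc_star f)" if "f \<in> set (fs @ gs)" for f
    unfolding S[OF that] by (intro sum_nonneg) auto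
  have "(\<Sum>f \<leftarrow> fs @ gs. word_eval ?L (f * nc_star f)) = 0"
  proof -
    have "word_eval ?L ((\<Sum>(f, g) \<leftarrow> cs. f * g - g * f) + (\<Sum>f \<leftarrow> fs. f * nc_star f)
         + (\<Sum>g \<leftarrow> gs. g * (1 - (\<Sum>i\<in>I. nc_var i ^ 2)) * nc_star g))
      = (\<Sum>f \<leftarrow> fs @ gs. word_eval ?L (f * nc_star f))"
      using deg by (intro word_eval_tr_qmodule[where k = k] palindrome_weight_cyclic[OF k])
        (auto simp: palindrome_weight_def)
    then show ?thesis using zero by simp
  qed
  then have "word_eval ?L (f * nc_star f) = 0"
    using nonneg f by (subst (asm) sum_list_nonneg_eq_0_iff) auto
  then have "\<forall>v\<in>Poly_Mapping.keys f. of_bool (length (letters v) = k) * (Poly_Mapping.lookup f v)^2 = 0"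
    unfolding S[OF f] by (subst (asm) sum_nonneg_eq_0_iff) auto
  then show ?thesis
    using deg[OF f] by (fastforce simp: min_degree_def in_keys_iff le_less Suc_le_eq)
qed

text \<open>The tracial functional attached to a doubly nonnegative \<open>X\<close>: a word of length 4 in the
  cyclic class of \<open>X\<^sub>i\<^sup>2 X\<^sub>j\<^sup>2\<close> gets the weight \<open>X\<^sub>i\<^sub>j\<close>, all other words get 0.\<close>

fun square_weight :: "'i mat \<Rightarrow> 'i list \<Rightarrow> real" where
  "square_weight X [a, b, c, d] =
     (if a = b \<and> c = d then X a c else if a = d \<and> b = c then X a b else 0)"
| "square_weight X _ = 0"

lemma square_weight_length: "square_weight X w \<noteq> 0 \<Longrightarrow> length w = 4"
  by (induction X w rule: square_weight.induct) auto

lemma square_weight_cyclic: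
  assumes "\<And>a b. X a b = X b a"
  shows "square_weight X (a # u) = square_weight X (u @ [a])"
proof (cases "length u = 3")
  case True
  then obtain b c d where "u = [b, c, d]"
    by (auto simp: numeral_3_eq_3 length_Suc_conv)
  moreover have "square_weight X [a, b, c, d] = square_weight X [b, c, d, a]"
    unfolding square_weight.simps using assms[of a b] by (smt (verit))
  ultimately show ?thesis by simp
next
  case False
  then have "length (a # u) \<noteq> 4" "length (u @ [a]) \<noteq> 4" by auto
  then show ?thesis using square_weight_length by metis
qed

text \<open>Makes the degree 2 coefficients of \<open>f\<close> an array over
  \<open>I \<times> I\<close>; words outside the support enter with coefficient 0. It serves once
  for each factor of \<open>f f*\<close>.\<close>

lemma sum_keys_length_two:
  assumes "finite I" "f \<in> nc_polys I"
    and "\<And>v. v \<in> Poly_Mapping.keys f \<Longrightarrow> length (letters v) \<noteq> 2 \<Longrightarrow> h (letters v) = 0"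
  shows "(\<Sum>v\<in>Poly_Mapping.keys f. Poly_Mapping.lookup f v * h (letters v))
    = (\<Sum>a\<in>I. \<Sum>b\<in>I. Poly_Mapping.lookup f (Monomial [a, b]) * (h [a, b] :: real))"
proof -
  let ?D = "(\<lambda>(a, b). Monomial [a, b]) ` (I \<times> I)"
  let ?g = "\<lambda>v. Poly_Mapping.lookup f v * h (letters v)"
  have outside: "?g v = 0" if v: "v \<in> Poly_Mapping.keys f" "v \<notin> ?D" for v
  proof -
    have "length (letters v) \<noteq> 2"
    proof
      assume "length (letters v) = 2"
      then obtain a b where ab: "letters v = [a, b]"
        by (auto simp: numeral_2_eq_2 length_Suc_conv)
      then have "v = Monomial [a, b]" by (cases v) simp
      moreover have "a \<in> I" "b \<in> I" using assms(2) v(1) ab by (auto simp: nc_polys_def)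
      ultimately show False using v(2) by auto
    qed
    then show ?thesis using assms(3) v(1) by simp
  qed
  have "sum ?g (Poly_Mapping.keys f) = sum ?g (Poly_Mapping.keys f \<union> ?D)"
    using assms(1) by (intro sum.mono_neutral_left) (auto simp: in_keys_iff)
  also have "\<dots> = sum ?g ?D"
    using assms(1) outside by (intro sum.mono_neutral_right) auto
  also have "\<dots> = (\<Sum>(a, b)\<in>I \<times> I. ?g (Monomial [a, b]))"
    by (subst sum.reindex) (auto simp: inj_on_def case_prod_unfold)
  finally show ?thesis by (simp add: sum.cartesian_product)
qed

text \<open>Let \<open>F\<close> be the array of degree 2 coefficients. Its diagonal contributes the
  quadratic form of \<open>X\<close>, and each off-diagonal entry contributes
  \<open>(F a b)^2 * X a b\<close>. The two halves of double nonnegativity control the two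
  parts.\<close>

lemma word_eval_square_weight:
  assumes "finite I" "f \<in> nc_polys I" "min_degree 2 f" "dnn_on I X"
  shows "0 \<le> word_eval (square_weight X) (f * nc_star f)"
proof -
  define F where "F a b = Poly_Mapping.lookup f (Monomial [a, b])" for a b
  have len: "2 \<le> length (letters v)" if "v \<in> Poly_Mapping.keys f" for v
    using that assms(3) by (auto simp: min_degree_def)
  have vanish: "square_weight X (letters v @ rev (letters w)) = 0"
    if "v \<in> Poly_Mapping.keys f" "w \<in> Poly_Mapping.keys f"
      "length (letters v) \<noteq> 2 \<or> length (letters w) \<noteq> 2" for v w
    using square_weight_length[of X "letters v @ rev (letters w)"] len[OF that(1)] len[OF that(2)] that(3)
    by fastforce
  have "word_eval (square_weight X) (f * nc_star f)
      = (\<Sum>v\<in>Poly_Mapping.keys f. Poly_Mapping.lookup f v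
         * (\<Sum>w\<in>Poly_Mapping.keys f. Poly_Mapping.lookup f w
            * square_weight X (letters v @ rev (letters w))))"
    by (rule word_eval_mult_star)
  also have "\<dots> = (\<Sum>a\<in>I. \<Sum>b\<in>I. F a b * (\<Sum>w\<in>Poly_Mapping.keys f. Poly_Mapping.lookup f w
            * square_weight X ([a, b] @ rev (letters w))))"
    unfolding F_def
    by (rule sum_keys_length_two[OF assms(1,2)]) (auto intro!: sum.neutral simp: vanish)
  also have "\<dots> = (\<Sum>a\<in>I. \<Sum>b\<in>I. F a b * (\<Sum>c\<in>I. \<Sum>d\<in>I. F c d * square_weight X [a, b, d, c]))"
  proof (intro sum.cong refl)
    fix a b
    have "(\<Sum>w\<in>Poly_Mapping.keys f. Poly_Mapping.lookup f w * square_weight X ([a, b] @ rev (letters w)))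
      = (\<Sum>c\<in>I. \<Sum>d\<in>I. F c d * square_weight X ([a, b] @ rev [c, d]))"
      unfolding F_def
    proof (rule sum_keys_length_two[OF assms(1,2)])
      fix w :: "'a monomial" assume "length (letters w) \<noteq> 2"
      then show "square_weight X ([a, b] @ rev (letters w)) = 0"
        using square_weight_length[of X "[a, b] @ rev (letters w)"] by fastforce
    qed
    then show "F a b * (\<Sum>w\<in>Poly_Mapping.keys f. Poly_Mapping.lookup f w
          * square_weight X ([a, b] @ rev (letters w)))
      = F a b * (\<Sum>c\<in>I. \<Sum>d\<in>I. F c d * square_weight X [a, b, d, c])" by simp
  qed
  also have "\<dots> = (\<Sum>a\<in>I. \<Sum>b\<in>I. (if a = b then F a a * (\<Sum>c\<in>I. X a c * F c c) else 0)
        + (if a = b then 0 else (F a b)^2 * X a b))"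
  proof (intro sum.cong refl)
    fix a b assume ab: "a \<in> I" "b \<in> I"
    have "(\<Sum>c\<in>I. \<Sum>d\<in>I. F c d * square_weight X [a, b, d, c])
        = (if a = b then (\<Sum>c\<in>I. X a c * F c c) else F a b * X a b)"
    proof (cases "a = b")
      case True
      have "(\<Sum>d\<in>I. F c d * square_weight X [a, b, d, c]) = X a c * F c c" if "c \<in> I" for c
      proof -
        have "(\<Sum>d\<in>I. F c d * square_weight X [a, b, d, c]) = (\<Sum>d\<in>I. if d = c then X a c * F c c else 0)"
          using True by (intro sum.cong) auto
        then show ?thesis using that assms(1) by simp
      qed
      then show ?thesis using True by simp
    next
      case False
      have "(\<Sum>d\<in>I. F c d * square_weight X [a, b, d, c]) = (if c = a then F a b * X a b else 0)" for c
      proof -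
        have "(\<Sum>d\<in>I. F c d * square_weight X [a, b, d, c])
            = (\<Sum>d\<in>I. if d = b then (if c = a then F a b * X a b else 0) else 0)"
          using False by (intro sum.cong) auto
        then show ?thesis using ab assms(1) by simp
      qed
      then show ?thesis using False ab assms(1) by simp
    qed
    then show "F a b * (\<Sum>c\<in>I. \<Sum>d\<in>I. F c d * square_weight X [a, b, d, c])
      = (if a = b then F a a * (\<Sum>c\<in>I. X a c * F c c) else 0)
        + (if a = b then 0 else (F a b)^2 * X a b)"
      by (simp add: power2_eq_square)
  qed
  also have "\<dots> = qform I X (\<lambda>a. F a a)
      + (\<Sum>a\<in>I. \<Sum>b\<in>I. if a = b then 0 else (F a b)^2 * X a b)"
    using assms(1) by (simp add: sum.distrib sum_distrib_left mult.assoc)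
  finally have eq: "word_eval (square_weight X) (f * nc_star f) = qform I X (\<lambda>a. F a a)
      + (\<Sum>a\<in>I. \<Sum>b\<in>I. if a = b then 0 else (F a b)^2 * X a b)" .
  have "0 \<le> (\<Sum>a\<in>I. \<Sum>b\<in>I. if a = b then 0 else (F a b)^2 * X a b)"
    using assms(4) by (intro sum_nonneg) (auto simp: dnn_on_def)
  moreover have "0 \<le> qform I X (\<lambda>a. F a a)"
    using assms(4) by (intro psd_on_qform) (simp add: dnn_on_def)
  ultimately show ?thesis unfolding eq by simp
qed

lemma K_nc_zero_pairing:
  assumes "finite I" "M \<in> K_nc 0 I" "dnn_on I X"
  shows "0 \<le> mat_inner I M X"
proof -
  \<comment> \<open>Cyclicity of \<open>square_weight\<close> asks for symmetry on the whole index
    type, hence the extension by zero.\<close>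
  define X' where "X' i j = (if i \<in> I \<and> j \<in> I then X i j else 0)" for i j
  have sym: "X' a b = X' b a" for a b
    using assms(3) psd_on_sym[of I X a b] by (simp add: X'_def dnn_on_def)
  have dnn: "dnn_on I X'"
    using assms(3) psd_on_cong[of I X' X] by (simp add: dnn_on_def X'_def)
  from assms(2) obtain cs fs gs where
    fg: "set fs \<subseteq> nc_polys I" "set gs \<subseteq> nc_polys I" and
    p: "mat_poly I M = (\<Sum>(f, g) \<leftarrow> cs. f * g - g * f) + (\<Sum>f \<leftarrow> fs. f * nc_star f)
         + (\<Sum>g \<leftarrow> gs. g * (1 - (\<Sum>i\<in>I. nc_var i ^ 2)) * nc_star g)"
    by (auto simp: K_nc_def tr_qmodule_ball_def nc_const_def)
  \<comment> \<open>All words of \<open>p_M\<close> have length 4, and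
    \<open>2 * k \<le> 2\<close>.\<close>
  have low: "word_eval (palindrome_weight k) (mat_poly I M) = 0" if "k \<le> 1" for k
    using that by (simp add: mat_poly_single word_eval_sum palindrome_weight_def)
  have deg1: "min_degree (Suc 0) f" if "f \<in> set (fs @ gs)" for f
    by (rule min_degree_step[OF _ min_degree_zero low[unfolded p] that]) auto
  have deg2: "min_degree (Suc (Suc 0)) f" if "f \<in> set (fs @ gs)" for f
    by (rule min_degree_step[OF _ deg1 low[unfolded p] that]) auto
  have "word_eval (square_weight X') (mat_poly I M)
      = (\<Sum>f \<leftarrow> fs @ gs. word_eval (square_weight X') (f * nc_star f))"
    unfolding p using deg2 square_weight_length[of X']
    by (intro word_eval_tr_qmodule[where k = 2] square_weight_cyclic[OF sym])
      (auto simp: numeral_2_eq_2)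
  also have "0 \<le> \<dots>"
    using fg deg2 by (intro sum_list_nonneg)
      (auto intro!: word_eval_square_weight[OF assms(1) _ _ dnn] simp: numeral_2_eq_2)
  also have "word_eval (square_weight X') (mat_poly I M) = mat_inner I M X"
    by (simp add: mat_poly_single word_eval_sum mat_inner_def X'_def)
  finally show ?thesis .
qed


section \<open>Block-diagonal matrices and the matrix \<open>n I - J\<close>\<close>

lemma sum_single_term:
  assumes "finite A" "a \<in> A" "\<And>x. x \<in> A \<Longrightarrow> x \<noteq> a \<Longrightarrow> f x = 0"
  shows "sum f A = f a"
  using assms sum.mono_neutral_right[of A "{a}" f] by auto

lemma psd_on_zero: "psd_on I (\<lambda>_ _. 0)"
  by (simp add: psd_on_def symmetric_on_def)

lemma psd_on_sum:
  assumes "\<And>k. k \<in> K \<Longrightarrow> psd_on I (M k)"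
  shows "psd_on I (\<lambda>i j. \<Sum>k\<in>K. M k i j)"
  using assms by (induction K rule: infinite_finite_induct) (auto intro: psd_on_zero psd_on_add)

lemma psd_on_Sigma:
  assumes "finite T" "\<And>t. t \<in> T \<Longrightarrow> finite (J t)" "\<And>t. t \<in> T \<Longrightarrow> psd_on (J t) (D t)"
  shows "psd_on (Sigma T J) (\<lambda>p q. if fst p = fst q then D (fst p) (snd p) (snd q) else 0)"
    (is "psd_on _ ?M")
proof (rule psd_onI)
  show "symmetric_on (Sigma T J) ?M"
    using assms(3) by (fastforce simp: symmetric_on_def psd_on_def)
  fix x
  have Sigma: "(\<Sum>p\<in>Sigma T J. g p) = (\<Sum>t\<in>T. \<Sum>a\<in>J t. g (t, a))" for g :: "_ \<Rightarrow> real"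
    using assms(1,2) by (simp add: sum.Sigma)
  have "qform (Sigma T J) ?M x = (\<Sum>t\<in>T. \<Sum>a\<in>J t. \<Sum>s\<in>T. \<Sum>b\<in>J s.
      x (t, a) * (if t = s then D t a b else 0) * x (s, b))"
    unfolding Sigma by (simp only: fst_conv snd_conv)
  also have "\<dots> = (\<Sum>t\<in>T. qform (J t) (D t) (\<lambda>a. x (t, a)))"
  proof (intro sum.cong refl)
    fix t a assume "t \<in> T"
    show "(\<Sum>s\<in>T. \<Sum>b\<in>J s. x (t, a) * (if t = s then D t a b else 0) * x (s, b))
        = (\<Sum>b\<in>J t. x (t, a) * D t a b * x (t, b))"
      by (subst sum_single_term[OF assms(1) \<open>t \<in> T\<close>]) auto
  qed
  also have "0 \<le> \<dots>"
    by (intro sum_nonneg psd_on_qform assms(3))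
  finally show "0 \<le> qform (Sigma T J) ?M x" .
qed

text \<open>Cauchy-Schwarz. It serves twice: for the solution \<open>n I\<close> of the theta-plus
  program, and for the colour factor of a block solution.\<close>

lemma psd_on_card_identity:
  assumes "finite I"
  shows "psd_on I (\<lambda>i j. (if i = j then real (card I) else 0) - 1)"
proof (rule psd_onI)
  show "symmetric_on I (\<lambda>i j. (if i = j then real (card I) else 0) - 1)"
    by (auto simp: symmetric_on_def)
  fix x :: "'a \<Rightarrow> real"
  have "x i * ((if i = j then real (card I) else 0) - 1) * x j
      = (if i = j then real (card I) * (x i)^2 else 0) - x i * x j" for i j
    by (simp add: power2_eq_square algebra_simps)
  then have "qform I (\<lambda>i j. (if i = j then real (card I) else 0) - 1) x
      = (\<Sum>i\<in>I. (x i)^2) * real (card I) - (\<Sum>i\<in>I. x i)^2"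
    using assms by (simp add: sum_subtractf power2_eq_square sum_product sum_distrib_left
        sum_distrib_right mult.commute)
  then show "0 \<le> qform I (\<lambda>i j. (if i = j then real (card I) else 0) - 1) x"
    using sum_squared_le_sum_of_squares[of x I] by simp
qed


subsection \<open>The parameter \<open>\<vartheta>\<^sup>+\<close>\<close>

lemma singleton_notin_complement_edges: "{u} \<notin> complement_edges V E"
  by (auto simp: complement_edges_def doubleton_eq_iff)

lemma theta_plus_feasible_ge_1:
  assumes "finite V" "V \<noteq> {}" "theta_plus_feasible V E t"
  shows "1 \<le> t"
proof -
  from assms obtain u where "u \<in> V" by blast
  from assms(3) obtain Z where "psd_on V (\<lambda>u v. Z u v - 1)" "\<forall>u\<in>V. Z u u = t"
    by (auto simp: theta_plus_feasible_def)
  then show ?thesis using psd_on_diag[OF assms(1) _ \<open>u \<in> V\<close>] \<open>u \<in> V\<close> by fastforce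
qed

text \<open>Adding a multiple of the identity raises the diagonal and leaves the zero pattern, which
  is off the diagonal, intact.\<close>

lemma theta_plus_feasible_mono:
  assumes "finite V" "theta_plus_feasible V E t" "t \<le> s"
  shows "theta_plus_feasible V E s"
proof -
  from assms(2) obtain Z where Z: "dnn_on V Z" "psd_on V (\<lambda>u v. Z u v - 1)" "\<forall>u\<in>V. Z u u = t"
    "\<forall>u\<in>V. \<forall>v\<in>V. {u, v} \<in> complement_edges V E \<longrightarrow> Z u v = 0"
    by (auto simp: theta_plus_feasible_def)
  let ?D = "\<lambda>u v. if u = v then s - t else 0"
  have "psd_on V ?D"
  proof (rule psd_onI)
    fix x
    have "qform V ?D x = (\<Sum>u\<in>V. (s - t) * (x u)^2)"
      using assms(1) by (intro sum.cong refl)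
        (subst sum_single_term, auto simp: power2_eq_square)
    then show "0 \<le> qform V ?D x" using assms(3) by (simp add: sum_nonneg)
  qed (auto simp: symmetric_on_def)
  then have "psd_on V (\<lambda>u v. Z u v + ?D u v)" "psd_on V (\<lambda>u v. (Z u v - 1) + ?D u v)"
    using Z(1,2) psd_on_add[of V Z] psd_on_add[OF Z(2)] unfolding dnn_on_def by blast+
  moreover have "(\<lambda>u v. (Z u v - 1) + ?D u v) = (\<lambda>u v. (Z u v + ?D u v) - 1)"
    by (simp add: fun_eq_iff)
  ultimately show ?thesis
    unfolding theta_plus_feasible_def dnn_on_def
    using Z assms(3) by (intro exI[of _ "\<lambda>u v. Z u v + ?D u v"])
      (auto simp: dnn_on_def singleton_notin_complement_edges)
qed

lemma theta_plus_feasible_card: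
  assumes "finite V"
  shows "theta_plus_feasible V E (real (card V))"
proof -
  let ?Z = "\<lambda>u v. if u = v then real (card V) else 0"
  have 1: "psd_on V (\<lambda>u v. ?Z u v - 1)" by (rule psd_on_card_identity[OF assms])
  have "psd_on V (\<lambda>u v. (?Z u v - 1) + 1 * 1)"
    by (intro psd_on_add 1 psd_on_outer)
  then have "psd_on V ?Z" by simp
  with 1 show ?thesis
    unfolding theta_plus_feasible_def dnn_on_def
    by (intro exI[of _ ?Z]) (auto simp: singleton_notin_complement_edges)
qed

text \<open>A \<open>LEAST\<close> over the reals says nothing until the minimum is known to exist.
  Solutions with diagonal at most \<open>n\<close> have all entries at most \<open>n\<close> in
  absolute value, so they form a compact set, and \<open>n I\<close> is among them.\<close>

lemma theta_plus_least:
  assumes "finite V" "V \<noteq> {}"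
  shows "theta_plus_feasible V E (theta_plus V E)"
    and "theta_plus_feasible V E t \<Longrightarrow> theta_plus V E \<le> t"
proof -
  let ?n = "real (card V)"
  from assms(2) obtain r where r: "r \<in> V" by blast
  define K where "K = {X :: 'a \<times> 'a \<Rightarrow> real. \<forall>p. X p \<in> (if p \<in> V \<times> V then {-?n..?n} else {0})}
    \<inter> ({X. psd_on V (\<lambda>u v. X (u, v) - 0)} \<inter> {X. psd_on V (\<lambda>u v. X (u, v) - 1)}
    \<inter> (\<Inter>u\<in>V. \<Inter>v\<in>V. {X. 0 \<le> X (u, v)}) \<inter> (\<Inter>u\<in>V. {X. X (u, u) = X (r, r)})
    \<inter> (\<Inter>u\<in>V. \<Inter>v\<in>{v \<in> V. {u, v} \<in> complement_edges V E}. {X. X (u, v) = 0}))"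
  have KI: "(\<lambda>p. if p \<in> V \<times> V then Z (fst p) (snd p) else 0) \<in> K" (is "?X \<in> K")
    if Z: "dnn_on V Z" "psd_on V (\<lambda>u v. Z u v - 1)" "\<forall>u\<in>V. Z u u = t"
    "\<forall>u\<in>V. \<forall>v\<in>V. {u, v} \<in> complement_edges V E \<longrightarrow> Z u v = 0" and t: "t \<le> ?n" for Z t
  proof -
    have "psd_on V Z" using Z(1) by (simp add: dnn_on_def)
    then have "\<bar>Z u v\<bar> \<le> ?n" if "u \<in> V" "v \<in> V" for u v
      using psd_on_abs_le[OF assms(1) _ that] Z(3) t that by simp
    moreover have "psd_on V (\<lambda>u v. ?X (u, v) - 0)" "psd_on V (\<lambda>u v. ?X (u, v) - 1)"
      using \<open>psd_on V Z\<close> Z(2)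
        psd_on_cong[of V "\<lambda>u v. ?X (u, v) - 0" Z]
        psd_on_cong[of V "\<lambda>u v. ?X (u, v) - 1" "\<lambda>u v. Z u v - 1"] by simp_all
    ultimately show ?thesis
      unfolding K_def using Z r by (auto simp: abs_le_iff minus_le_iff dnn_on_def)
  qed
  have KD: "theta_plus_feasible V E (X (r, r))" if "X \<in> K" for X
    unfolding theta_plus_feasible_def dnn_on_def
    using that by (intro exI[of _ "\<lambda>u v. X (u, v)"]) (auto simp: K_def)
  have "compact K"
    unfolding K_def
    by (intro compact_Int_closed compact_box closed_Int closed_psd_on closed_INT ballI
        closed_Collect_le closed_Collect_eq continuous_intros continuous_on_product_coordinates)
  moreover have "K \<noteq> {}"
    using theta_plus_feasible_card[OF assms(1), of E] KI
    unfolding theta_plus_feasible_def by blast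
  moreover have "continuous_on K (\<lambda>X. X (r, r))"
    by (rule continuous_on_subset[OF continuous_on_product_coordinates]) simp
  ultimately obtain X where X: "X \<in> K" and min: "\<And>Y. Y \<in> K \<Longrightarrow> X (r, r) \<le> Y (r, r)"
    using continuous_attains_inf by metis
  have le: "X (r, r) \<le> t" if "theta_plus_feasible V E t" for t
  proof -
    \<comment> \<open>The compact set contains only solutions with diagonal at most
      \<open>n\<close>; larger \<open>t\<close> are replaced by \<open>n\<close>.\<close>
    let ?s = "min t ?n"
    have "theta_plus_feasible V E ?s"
      using that theta_plus_feasible_card[OF assms(1), of E] by (simp add: min_def)
    then obtain Z where "dnn_on V Z" "psd_on V (\<lambda>u v. Z u v - 1)" "\<forall>u\<in>V. Z u u = ?s"
      "\<forall>u\<in>V. \<forall>v\<in>V. {u, v} \<in> complement_edges V E \<longrightarrow> Z u v = 0"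
      unfolding theta_plus_feasible_def by blast
    from min[OF KI[OF this]] have "X (r, r) \<le> Z r r" using r by simp
    also have "Z r r = ?s" using \<open>\<forall>u\<in>V. Z u u = ?s\<close> r by blast
    finally show ?thesis by simp
  qed
  have "theta_plus V E = X (r, r)"
    unfolding theta_plus_def using KD[OF X] le by (rule Least_equality)
  then show "theta_plus_feasible V E (theta_plus V E)"
    and "theta_plus_feasible V E t \<Longrightarrow> theta_plus V E \<le> t"
    using KD[OF X] le by simp_all
qed


subsection \<open>A single block\<close>

definition A_block :: "'v set \<Rightarrow> 'v bidx mat" where
  "A_block V a b = (\<Sum>u\<in>V. A_vertex u a b)"

text \<open>The vector \<open>e_0 - sum_i e_ui\<close>, whose outer square is
  \<open>A_vertex u\<close>. A positive semidefinite \<open>X\<close> orthogonal to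
  \<open>A_block V\<close> annihilates it for every \<open>u\<close>; for a colouring this says that
  \<open>u\<close> has exactly one colour.\<close>

fun vertex_vec :: "'v \<Rightarrow> 'v bidx \<Rightarrow> real" where
  "vertex_vec u None = 1"
| "vertex_vec u (Some (v, i)) = (if v = u then -1 else 0)"

text \<open>The positions that carry free multipliers: two colours at one vertex, or one colour at
  both ends of an edge.\<close>

fun zero_pattern :: "'v set set \<Rightarrow> 'v bidx \<Rightarrow> 'v bidx \<Rightarrow> bool" where
  "zero_pattern E (Some (u, i)) (Some (v, j)) \<longleftrightarrow> (if u = v then i \<noteq> j else i = j \<and> {u, v} \<in> E)"
| "zero_pattern E _ _ \<longleftrightarrow> False"

definition block_feasible :: "'v set \<Rightarrow> 'v set set \<Rightarrow> nat \<Rightarrow> 'v bidx mat \<Rightarrow> bool" where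
  "block_feasible V E t X \<longleftrightarrow> dnn_on (block_index V t) X \<and> X None None = 1
     \<and> mat_inner (block_index V t) (A_block V) X = 0
     \<and> (\<forall>a\<in>block_index V t. \<forall>b\<in>block_index V t. zero_pattern E a b \<longrightarrow> X a b = 0)"

lemma zero_pattern_sym: "zero_pattern E a b \<longleftrightarrow> zero_pattern E b a"
proof (cases "(E, a, b)" rule: zero_pattern.cases)
  case (1 E' u i v j)
  then show ?thesis by (cases "u = v") (auto simp: insert_commute)
qed (auto elim: zero_pattern.elims)

lemma finite_block_index: "finite V \<Longrightarrow> finite (block_index V t)"
  by (simp add: block_index_def)

lemma sum_block_index:
  assumes "finite V"
  shows "(\<Sum>a\<in>block_index V t. f a) = f None + (\<Sum>u\<in>V. \<Sum>i=1..t. f (Some (u, i)))"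
proof -
  have "None \<notin> Some ` (V \<times> {1..t})" by blast
  then show ?thesis
    using assms by (simp add: block_index_def sum.reindex sum.cartesian_product case_prod_unfold)
qed

lemma A_vertex_outer: "A_vertex u a b = vertex_vec u a * vertex_vec u b"
  by (cases "(u, a, b)" rule: A_vertex.cases) auto

lemma psd_on_A_block: "psd_on I (A_block V)"
  unfolding A_block_def[abs_def] A_vertex_outer by (intro psd_on_sum psd_on_outer)

lemma mat_inner_A_block:
  "mat_inner I (A_block V) X = (\<Sum>u\<in>V. qform I X (vertex_vec u))"
proof -
  have "mat_inner I (A_block V) X
      = (\<Sum>a\<in>I. \<Sum>b\<in>I. \<Sum>u\<in>V. vertex_vec u a * X a b * vertex_vec u b)"
    by (simp add: mat_inner_def A_block_def A_vertex_outer sum_distrib_left sum_distrib_right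
        mult_ac)
  also have "\<dots> = (\<Sum>a\<in>I. \<Sum>u\<in>V. \<Sum>b\<in>I. vertex_vec u a * X a b * vertex_vec u b)"
    by (intro sum.cong refl sum.swap)
  also have "\<dots> = (\<Sum>u\<in>V. qform I X (vertex_vec u))" by (rule sum.swap)
  finally show ?thesis .
qed

lemma sum_vertex_vec:
  assumes "finite V" "u \<in> V"
  shows "(\<Sum>a\<in>block_index V t. g a * vertex_vec u a) = g None - (\<Sum>i=1..t. g (Some (u, i)))"
proof -
  have "(\<Sum>v\<in>V. \<Sum>i=1..t. g (Some (v, i)) * vertex_vec u (Some (v, i)))
      = (\<Sum>i=1..t. g (Some (u, i)) * vertex_vec u (Some (u, i)))"
    by (rule sum_single_term[OF assms]) simp
  then show ?thesis by (simp add: sum_block_index[OF assms(1)] sum_negf)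
qed

lemma qform_vertex_vec:
  assumes "finite V" "u \<in> V"
  shows "qform (block_index V t) X (vertex_vec u)
    = X None None - (\<Sum>i=1..t. X None (Some (u, i))) - (\<Sum>i=1..t. X (Some (u, i)) None)
      + (\<Sum>i=1..t. \<Sum>j=1..t. X (Some (u, i)) (Some (u, j)))"
proof -
  let ?g = "\<lambda>a. X a None - (\<Sum>j=1..t. X a (Some (u, j)))"
  have "qform (block_index V t) X (vertex_vec u)
      = (\<Sum>a\<in>block_index V t. (\<Sum>b\<in>block_index V t. X a b * vertex_vec u b) * vertex_vec u a)"
    by (simp add: sum_distrib_left sum_distrib_right mult_ac)
  also have "\<dots> = (\<Sum>a\<in>block_index V t. ?g a * vertex_vec u a)"
    by (simp only: sum_vertex_vec[OF assms])
  also have "\<dots> = ?g None - (\<Sum>i=1..t. ?g (Some (u, i)))"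
    by (rule sum_vertex_vec[OF assms])
  finally show ?thesis by (simp add: sum_subtractf)
qed

text \<open>Summing the diagonal colour blocks of \<open>X\<close> and scaling by \<open>t\<close>
  gives \<open>Z\<close>. Each colour block dominates the outer square of its part of row 0, and
  these parts add up to the all-ones vector.\<close>

lemma block_feasible_imp_theta_plus_feasible:
  assumes G: "simple_graph V E" and X: "block_feasible V E t X"
  shows "theta_plus_feasible V (complement_edges V E) (real t)"
proof -
  have fin: "finite V" using G by (simp add: simple_graph_def)
  let ?B = "block_index V t"
  have B: "None \<in> ?B" "\<And>u i. u \<in> V \<Longrightarrow> i \<in> {1..t} \<Longrightarrow> Some (u, i) \<in> ?B"
    by (auto simp: block_index_def)
  have psd: "psd_on ?B X" and nonneg: "\<And>a b. a \<in> ?B \<Longrightarrow> b \<in> ?B \<Longrightarrow> 0 \<le> X a b"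
    and X00: "X None None = 1" and inner: "mat_inner ?B (A_block V) X = 0"
    and zero: "\<And>a b. a \<in> ?B \<Longrightarrow> b \<in> ?B \<Longrightarrow> zero_pattern E a b \<Longrightarrow> X a b = 0"
    using X by (auto simp: block_feasible_def dnn_on_def)
  \<comment> \<open>The values of the form at all \<open>vertex_vec u\<close> are nonnegative and
    sum to 0, so each vector lies in the kernel of \<open>X\<close>.\<close>
  have row: "X b None = (\<Sum>i=1..t. X b (Some (u, i)))" if "u \<in> V" "b \<in> ?B" for u b
  proof -
    have "qform ?B X (vertex_vec u) = 0"
      using inner that(1) fin psd_on_qform[OF psd] unfolding mat_inner_A_block
      by (subst (asm) sum_nonneg_eq_0_iff) auto
    from psd_on_kernel[OF finite_block_index[OF fin] psd this that(2)]
    show ?thesis by (simp add: sum_vertex_vec[OF fin that(1)])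
  qed
  have sum1: "(\<Sum>i=1..t. X None (Some (u, i))) = 1" if "u \<in> V" for u
    using row[OF that B(1)] X00 by simp
  have diag: "X (Some (u, i)) (Some (u, i)) = X None (Some (u, i))" if u: "u \<in> V" "i \<in> {1..t}" for u i
  proof -
    have "(\<Sum>j=1..t. X (Some (u, i)) (Some (u, j))) = X (Some (u, i)) (Some (u, i))"
      by (rule sum_single_term) (use u in \<open>auto intro!: zero B\<close>)
    then show ?thesis
      using row[OF u(1) B(2)[OF u]] psd_on_sym[OF psd B(1) B(2)[OF u]] by simp
  qed
  define Z where "Z u v = real t * (\<Sum>i=1..t. X (Some (u, i)) (Some (v, i)))" for u v
  have symZ: "Z u v = Z v u" if "u \<in> V" "v \<in> V" for u v
    unfolding Z_def using that by (intro arg_cong2[of _ _ _ _ "(*)"] refl sum.cong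
        psd_on_sym[OF psd] B)
  have "psd_on V (\<lambda>u v. Z u v - 1)"
  proof (rule psd_onI)
    show "symmetric_on V (\<lambda>u v. Z u v - 1)"
      unfolding symmetric_on_def using symZ by metis
    fix x :: "'a \<Rightarrow> real"
    define c where "c i = (\<Sum>u\<in>V. X None (Some (u, i)) * x u)" for i
    define q where "q i = (\<Sum>u\<in>V. \<Sum>v\<in>V. x u * X (Some (u, i)) (Some (v, i)) * x v)" for i
    have qc: "(c i)^2 \<le> q i" if i: "i \<in> {1..t}" for i
    proof -
      \<comment> \<open>The entry \<open>- c i\<close> at index 0 minimises the form for given
        \<open>x\<close>, so that \<open>qc\<close> is the Schur complement inequality for the pivot
        \<open>X None None = 1\<close>.\<close>
      define w where "w a = (case a of None \<Rightarrow> - c i | Some (v, j) \<Rightarrow> if j = i then x v else 0)"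
        for a :: "'a bidx"
      have sum_w: "(\<Sum>a\<in>?B. g a * w a) = (\<Sum>v\<in>V. g (Some (v, i)) * x v) - g None * c i" for g
      proof -
        have "(\<Sum>j=1..t. g (Some (v, j)) * w (Some (v, j))) = g (Some (v, i)) * x v" for v
          by (subst sum_single_term[of _ i]) (use i in \<open>auto simp: w_def\<close>)
        then show ?thesis by (simp add: sum_block_index[OF fin] w_def)
      qed
      have "qform ?B X w = (\<Sum>a\<in>?B. (\<Sum>b\<in>?B. X a b * w b) * w a)"
        by (simp add: sum_distrib_left sum_distrib_right mult_ac)
      also have "\<dots> = (\<Sum>v\<in>V. ((\<Sum>u\<in>V. X (Some (v, i)) (Some (u, i)) * x u)
          - X (Some (v, i)) None * c i) * x v) - (c i - c i) * c i"
        unfolding sum_w c_def[symmetric] using X00 by simp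
      also have "\<dots> = q i - (\<Sum>v\<in>V. X (Some (v, i)) None * x v) * c i"
        unfolding q_def by (simp add: algebra_simps sum_subtractf sum_distrib_left sum_distrib_right)
      also have "(\<Sum>v\<in>V. X (Some (v, i)) None * x v) = c i"
        unfolding c_def using psd_on_sym[OF psd B(1) B(2)] i by (intro sum.cong) auto
      finally show ?thesis using psd_on_qform[OF psd, of w] by (simp add: power2_eq_square)
    qed
    \<comment> \<open>By \<open>sum1\<close> the \<open>c i\<close> add up to the sum of
      \<open>x\<close>; Cauchy-Schwarz over the colours costs the factor \<open>t\<close> built into
      \<open>Z\<close>.\<close>
    have "(\<Sum>u\<in>V. x u) = (\<Sum>u\<in>V. (\<Sum>i=1..t. X None (Some (u, i))) * x u)"
      by (intro sum.cong refl) (simp only: sum1 mult_1_left)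
    also have "\<dots> = (\<Sum>i=1..t. c i)"
      unfolding c_def sum_distrib_right by (rule sum.swap)
    finally have "(\<Sum>u\<in>V. x u)^2 \<le> (\<Sum>i=1..t. (c i)^2) * real t"
      using sum_squared_le_sum_of_squares[of c "{1..t}"] by simp
    also have "\<dots> \<le> (\<Sum>i=1..t. q i) * real t"
      by (intro mult_right_mono sum_mono qc) auto
    also have "(\<Sum>i=1..t. q i) * real t = qform V Z x"
    proof -
      have "(\<Sum>i=1..t. q i)
          = (\<Sum>u\<in>V. \<Sum>i=1..t. \<Sum>v\<in>V. x u * X (Some (u, i)) (Some (v, i)) * x v)"
        unfolding q_def by (rule sum.swap)
      also have "\<dots> = (\<Sum>u\<in>V. \<Sum>v\<in>V. \<Sum>i=1..t. x u * X (Some (u, i)) (Some (v, i)) * x v)"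
        by (intro sum.cong refl sum.swap)
      finally show ?thesis
        by (simp add: Z_def sum_distrib_left sum_distrib_right mult_ac)
    qed
    finally show "0 \<le> qform V (\<lambda>u v. Z u v - 1) x"
      by (simp add: power2_eq_square sum_product sum_subtractf algebra_simps)
  qed
  moreover from psd_on_add[OF this psd_on_outer[of V "\<lambda>_. 1"]] have "psd_on V Z" by simp
  moreover have "0 \<le> Z u v" if "u \<in> V" "v \<in> V" for u v
    unfolding Z_def using that by (intro mult_nonneg_nonneg sum_nonneg nonneg B) auto
  moreover have "Z u u = real t" if "u \<in> V" for u
    unfolding Z_def using diag[OF that] sum1[OF that] by simp
  moreover have "Z u v = 0" if "u \<in> V" "v \<in> V" "{u, v} \<in> E" for u v
  proof -
    have "u \<noteq> v" using G that(3) by (auto simp: simple_graph_def doubleton_eq_iff)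
    then have "X (Some (u, i)) (Some (v, i)) = 0" if "i \<in> {1..t}" for i
      using \<open>u \<in> V\<close> \<open>v \<in> V\<close> \<open>{u, v} \<in> E\<close> that by (intro zero B) auto
    then show ?thesis by (simp add: Z_def)
  qed
  ultimately show ?thesis
    unfolding theta_plus_feasible_complement[OF G] dnn_on_def by blast
qed

text \<open>A solution invariant under permutations of the colours is built. Entries with equal
  colours are \<open>Z u v / t^2\<close>; the row sums \<open>1 / t\<close> then force
  \<open>(t - Z u v) / (t^2 * (t - 1))\<close> for distinct colours, which is nonnegative because
  the diagonal value \<open>t\<close> bounds all entries of \<open>Z\<close>.\<close>

lemma theta_plus_feasible_imp_block_feasible:
  assumes G: "simple_graph V E" and t: "1 \<le> t"
    and Z: "theta_plus_feasible V (complement_edges V E) (real t)"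
  shows "\<exists>X. block_feasible V E t X"
proof -
  have fin: "finite V" using G by (simp add: simple_graph_def)
  let ?B = "block_index V t"
  let ?m = "real t"
  from Z obtain Z where dnn: "dnn_on V Z" and psdW: "psd_on V (\<lambda>u v. Z u v - 1)"
    and diag: "\<And>u. u \<in> V \<Longrightarrow> Z u u = ?m"
    and zero: "\<And>u v. u \<in> V \<Longrightarrow> v \<in> V \<Longrightarrow> {u, v} \<in> E \<Longrightarrow> Z u v = 0"
    unfolding theta_plus_feasible_complement[OF G] by blast
  have le: "Z u v \<le> ?m" if "u \<in> V" "v \<in> V" for u v
    using psd_on_abs_le[OF fin _ that, of Z ?m] dnn diag that by (simp add: dnn_on_def)
  \<comment> \<open>With \<open>W = Z - J\<close>, the solution is \<open>X = c c\<^sup>T + W \<otimes> K\<close>. For \<open>t = 1\<close> the off-diagonal value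
    of \<open>K\<close>, a division by zero, is never used.\<close>
  define K where "K i j = (if i = j then 1 / ?m^2 else - 1 / (?m^2 * (?m - 1)))" for i j :: nat
  have psdK: "psd_on {1..t} K"
  proof (cases "t = 1")
    case True
    have "psd_on {1..t} (\<lambda>_ _. 1 * 1)" by (rule psd_on_outer)
    then show ?thesis using True by (subst psd_on_cong[where N = "\<lambda>_ _. 1 * 1"]) (auto simp: K_def)
  next
    case False
    then have m: "?m - 1 > 0" using t by simp
    \<comment> \<open>For \<open>t > 1\<close>, \<open>K\<close> is a positive multiple of
      \<open>t I - J\<close>.\<close>
    let ?N = "\<lambda>i j. 1 / (?m^2 * (?m - 1)) * ((if i = j then real (card {1..t}) else 0) - 1)"
    have "psd_on {1..t} ?N"
      by (intro psd_on_scale psd_on_card_identity) (use m in auto)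
    moreover have "K i j = ?N i j" for i j
      using m by (auto simp: K_def)
    ultimately show ?thesis by (subst psd_on_cong[where N = ?N]) auto
  qed
  define c where "c a = (case a of None \<Rightarrow> 1 | Some _ \<Rightarrow> 1 / ?m)" for a :: "'a bidx"
  define S where "S a b = (case (a, b) of (Some (u, i), Some (v, j)) \<Rightarrow> (Z u v - 1) * K i j | _ \<Rightarrow> 0)"
    for a b :: "'a bidx"
  define X where "X a b = c a * c b + S a b" for a b
  have psdS: "psd_on ?B S"
  proof -
    \<comment> \<open>A Kronecker product is positive semidefinite: the products of Gram vectors of
      the factors are Gram vectors for it.\<close>
    from psd_on_gram[OF fin psdW] obtain n1 f
      where f: "\<And>u v. u \<in> V \<Longrightarrow> v \<in> V \<Longrightarrow> Z u v - 1 = (\<Sum>k<(n1::nat). f k u * f k v)" by blast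
    from psd_on_gram[OF _ psdK] obtain n2 g
      where g: "\<And>i j. i \<in> {1..t} \<Longrightarrow> j \<in> {1..t} \<Longrightarrow> K i j = (\<Sum>l<(n2::nat). g l i * g l j)" by blast
    define h where "h k l a = (case a of None \<Rightarrow> 0 | Some (u, i) \<Rightarrow> f k u * g l i)"
      for k l and a :: "'a bidx"
    let ?N = "\<lambda>a b. \<Sum>k<n1. \<Sum>l<n2. h k l a * h k l b"
    have "psd_on ?B ?N" by (intro psd_on_sum psd_on_outer)
    moreover have "S a b = ?N a b" if "a \<in> ?B" "b \<in> ?B" for a b
      using that f g by (auto simp: S_def h_def block_index_def sum_product mult_ac)
    ultimately show ?thesis by (subst psd_on_cong[where N = ?N]) auto
  qed
  have psdX: "psd_on ?B X"
    unfolding X_def[abs_def] by (intro psd_on_add psd_on_outer psdS)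
  have X0: "X None None = 1" "X None (Some (u, i)) = 1 / ?m" "X (Some (u, i)) None = 1 / ?m" for u i
    by (simp_all add: X_def c_def S_def)
  have X1: "X (Some (u, i)) (Some (v, i)) = Z u v / ?m^2" for u v i
    by (simp add: X_def c_def S_def K_def power2_eq_square diff_divide_distrib)
  have X2: "X (Some (u, i)) (Some (v, j)) = (?m - Z u v) / (?m^2 * (?m - 1))"
    if "i \<in> {1..t}" "j \<in> {1..t}" "i \<noteq> j" for u v i j
  proof -
    have "?m - 1 \<noteq> 0" using that by auto
    then have "1 / ?m * (1 / ?m) = (?m - 1) / (?m^2 * (?m - 1))" by (simp add: power2_eq_square)
    moreover have "(x - 1) * (- 1 / d) = (1 - x) / d" for x d :: real
      by (cases "d = 0") (simp_all add: field_simps)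
    ultimately have "1 / ?m * (1 / ?m) + (Z u v - 1) * (- 1 / (?m^2 * (?m - 1)))
        = (?m - Z u v) / (?m^2 * (?m - 1))"
      by (simp only: add_divide_distrib[symmetric]) simp
    then show ?thesis using that(3) by (simp add: X_def c_def S_def K_def)
  qed
  have "0 \<le> X a b" if ab: "a \<in> ?B" "b \<in> ?B" for a b
  proof (cases "a = None \<or> b = None")
    case True
    then show ?thesis using ab X0 by (auto simp: block_index_def)
  next
    case False
    then obtain u i v j where *: "a = Some (u, i)" "b = Some (v, j)"
      "u \<in> V" "v \<in> V" "i \<in> {1..t}" "j \<in> {1..t}"
      using ab by (auto simp: block_index_def)
    show ?thesis
    proof (cases "i = j")
      case True
      then show ?thesis using * X1 dnn by (simp add: dnn_on_def)
    next
      case False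
      then show ?thesis using * X2[OF *(5,6)] le[OF *(3,4)] t by simp
    qed
  qed
  moreover have "mat_inner ?B (A_block V) X = 0"
    unfolding mat_inner_A_block
  proof (rule sum.neutral, rule ballI)
    fix u assume u: "u \<in> V"
    have "(\<Sum>j=1..t. X (Some (u, i)) (Some (u, j))) = 1 / ?m" if "i \<in> {1..t}" for i
    proof -
      have "(\<Sum>j=1..t. X (Some (u, i)) (Some (u, j))) = X (Some (u, i)) (Some (u, i))"
        by (rule sum_single_term) (use that u in \<open>auto simp: X2 diag\<close>)
      then show ?thesis using X1 diag[OF u] by (simp add: power2_eq_square)
    qed
    then show "qform ?B X (vertex_vec u) = 0"
      using t by (simp add: qform_vertex_vec[OF fin u] X0)
  qed
  moreover have "X a b = 0" if "a \<in> ?B" "b \<in> ?B" "zero_pattern E a b" for a b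
    using that X2 X1 diag zero by (auto simp: block_index_def split: if_splits)
  ultimately have "block_feasible V E t X"
    using psdX X0 by (auto simp: block_feasible_def dnn_on_def)
  then show ?thesis by blast
qed

text \<open>The compactness hypothesis of the alternative. Near-orthogonality to \<open>A\<close>
  bounds, for each vertex, the sum of its colour block by its part of row 0. The pattern keeps
  off-diagonal entries of that block above \<open>-1\<close>, and row 0 grows only like the square
  root of the diagonal.\<close>

lemma block_diag_bound:
  assumes fin: "finite V" and psd: "psd_on (block_index V t) X" and X00: "X None None \<le> 2"
    and inner: "mat_inner (block_index V t) (A_block V) X \<le> 1"
    and small: "\<And>a b. a \<in> block_index V t \<Longrightarrow> b \<in> block_index V t \<Longrightarrow> zero_pattern E a b
      \<Longrightarrow> \<bar>X a b\<bar> \<le> 1"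
    and a: "a \<in> block_index V t"
  shows "X a a \<le> 2 * (1 + (real t)^2 + 4 * real t)"
proof (cases a)
  case None
  have "2 \<le> 2 * (1 + (real t)^2 + 4 * real t)" by simp
  with X00 show ?thesis unfolding None by (rule order_trans)
next
  case (Some p)
  then obtain u k where p: "a = Some (u, k)" and u: "u \<in> V" and k: "k \<in> {1..t}"
    using a by (auto simp: block_index_def)
  let ?B = "block_index V t"
  have B: "None \<in> ?B" "\<And>i. i \<in> {1..t} \<Longrightarrow> Some (u, i) \<in> ?B"
    using u by (auto simp: block_index_def)
  let ?d = "\<lambda>i. X (Some (u, i)) (Some (u, i))"
  have finB: "finite ?B" by (rule finite_block_index[OF fin])
  have "qform ?B X (vertex_vec u) \<le> (\<Sum>u\<in>V. qform ?B X (vertex_vec u))"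
    by (rule member_le_sum[OF u psd_on_qform[OF psd] fin])
  then have "qform ?B X (vertex_vec u) \<le> 1" using inner by (simp add: mat_inner_A_block)
  moreover have "(\<Sum>i=1..t. X (Some (u, i)) None) = (\<Sum>i=1..t. X None (Some (u, i)))"
    by (intro sum.cong refl psd_on_sym[OF psd] B)
  ultimately have "X None None + (\<Sum>i=1..t. \<Sum>j=1..t. X (Some (u, i)) (Some (u, j)))
      \<le> 1 + (\<Sum>i=1..t. 2 * X None (Some (u, i)))"
    by (simp add: qform_vertex_vec[OF fin u] sum_distrib_left[symmetric])
  moreover have "0 \<le> X None None" by (rule psd_on_diag[OF finB psd B(1)])
  moreover have "(\<Sum>i=1..t. ?d i - real t) \<le> (\<Sum>i=1..t. \<Sum>j=1..t. X (Some (u, i)) (Some (u, j)))"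
  proof (rule sum_mono)
    fix i assume i: "i \<in> {1..t}"
    have "?d i - real t = (\<Sum>j=1..t. (if j = i then ?d i else 0) - 1)"
      using i by (simp add: sum_subtractf)
    also have "\<dots> \<le> (\<Sum>j=1..t. X (Some (u, i)) (Some (u, j)))"
    proof (rule sum_mono)
      fix j assume j: "j \<in> {1..t}"
      show "(if j = i then ?d i else 0) - 1 \<le> X (Some (u, i)) (Some (u, j))"
        using small[OF B(2)[OF i] B(2)[OF j]] by (auto simp: abs_le_iff)
    qed
    finally show "?d i - real t \<le> (\<Sum>j=1..t. X (Some (u, i)) (Some (u, j)))" .
  qed
  moreover have "(\<Sum>i=1..t. 2 * X None (Some (u, i))) \<le> (\<Sum>i=1..t. 4 + ?d i / 2)"
  proof (rule sum_mono)
    fix i assume i: "i \<in> {1..t}"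
    show "2 * X None (Some (u, i)) \<le> 4 + ?d i / 2"
      \<comment> \<open>The weights 2 and \<open>-1\<close> leave only half of the diagonal on the
        right, to be absorbed on the left; this is the origin of the leading 2 in the bound.\<close>
      using psd_on_pair[OF finB psd B(1) B(2)[OF i], of 2 "-1"] X00 by simp
  qed
  ultimately have "(\<Sum>i=1..t. ?d i) - (real t)^2 \<le> 1 + 4 * real t + (\<Sum>i=1..t. ?d i) / 2"
    by (simp add: sum_subtractf sum.distrib sum_divide_distrib power2_eq_square)
  moreover have "?d k \<le> (\<Sum>i=1..t. ?d i)"
    by (rule member_le_sum[OF k]) (auto intro!: psd_on_diag[OF finB psd] B)
  ultimately show ?thesis unfolding p by simp
qed

lemma block_certificate:
  assumes G: "simple_graph V E" and infeasible: "\<not> (\<exists>X. block_feasible V E t X)"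
  shows "\<exists>s Y N. 0 < s \<and> symmetric_on (block_index V t) Y
    \<and> (\<forall>a\<in>block_index V t. \<forall>b\<in>block_index V t. \<not> zero_pattern E a b \<longrightarrow> Y a b = 0)
    \<and> symmetric_on (block_index V t) N
    \<and> (\<forall>a\<in>block_index V t. \<forall>b\<in>block_index V t. 0 \<le> N a b)
    \<and> psd_on (block_index V t) (\<lambda>a b. A_block V a b - (if a = None \<and> b = None then s else 0)
        + Y a b - N a b)"
proof (rule dnn_alternative)
  have fin: "finite V" using G by (simp add: simple_graph_def)
  show "finite (block_index V t)" by (rule finite_block_index[OF fin])
  show "None \<in> block_index V t" by (simp add: block_index_def)
  show "psd_on (block_index V t) (A_block V)" by (rule psd_on_A_block)
  show "zero_pattern E a b = zero_pattern E b a" for a b by (rule zero_pattern_sym)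
  show "\<forall>a\<in>block_index V t. X a a \<le> 2 * (1 + (real t)^2 + 4 * real t)"
    if "psd_on (block_index V t) X" "X None None \<le> 2"
      "mat_inner (block_index V t) (A_block V) X \<le> 1"
      "\<And>a b. a \<in> block_index V t \<Longrightarrow> b \<in> block_index V t \<Longrightarrow> zero_pattern E a b
        \<Longrightarrow> \<bar>X a b\<bar> \<le> 1" for X
    using block_diag_bound[OF fin that] by blast
  show "\<not> (\<exists>X. dnn_on (block_index V t) X \<and> X None None = 1
      \<and> mat_inner (block_index V t) (A_block V) X = 0
      \<and> (\<forall>a\<in>block_index V t. \<forall>b\<in>block_index V t. zero_pattern E a b \<longrightarrow> X a b = 0))"
    using infeasible by (simp add: block_feasible_def)
qed


subsection \<open>The multipliers\<close>

definition multiplier_block :: "'v set \<Rightarrow> 'v set set \<Rightarrow> (nat \<Rightarrow> 'v set \<Rightarrow> nat \<Rightarrow> real) \<Rightarrow>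
    (nat \<Rightarrow> 'v \<Rightarrow> nat \<Rightarrow> nat \<Rightarrow> real) \<Rightarrow> nat \<Rightarrow> 'v bidx mat" where
  "multiplier_block V E y z t a b =
     (\<Sum>i = 1..t. \<Sum>e\<in>E. y t e i * elem_sym ((\<lambda>u. Some (u, i)) ` e) a b)
     + (\<Sum>i = 1..t. \<Sum>j \<in> {1..t} - {i}. \<Sum>u\<in>V. z t u i j * elem_sym {Some (u, i), Some (u, j)} a b)"

lemma elem_sym_ext_apply:
  "elem_sym_ext t S (r, a) (s, b) = (if r = s \<and> s = t then elem_sym S a b else 0)"
  by (simp add: elem_sym_ext_def direct_sum_def)

lemma Psi_matrix_block:
  assumes "s \<in> {1..card V}"
  shows "Psi_matrix V E l \<mu> y z (r, a) (s, b) = (if r = s then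
      (if a = None \<and> b = None then real s - l else 0) - \<mu> * A_block V a b
        - multiplier_block V E y z s a b else 0)"
proof (cases "r = s")
  case True
  have "(\<Sum>t = 1..card V. \<Sum>i = 1..t. \<Sum>e\<in>E.
          y t e i * elem_sym_ext t ((\<lambda>u. Some (u, i)) ` e) (r, a) (s, b))
      = (\<Sum>i = 1..s. \<Sum>e\<in>E. y s e i * elem_sym_ext s ((\<lambda>u. Some (u, i)) ` e) (r, a) (s, b))"
    by (rule sum_single_term[OF _ assms]) (auto simp: elem_sym_ext_apply)
  moreover have "(\<Sum>t = 1..card V. \<Sum>i = 1..t. \<Sum>j \<in> {1..t} - {i}. \<Sum>u\<in>V.
          z t u i j * elem_sym_ext t {Some (u, i), Some (u, j)} (r, a) (s, b))
      = (\<Sum>i = 1..s. \<Sum>j \<in> {1..s} - {i}. \<Sum>u\<in>V.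
          z s u i j * elem_sym_ext s {Some (u, i), Some (u, j)} (r, a) (s, b))"
    by (rule sum_single_term[OF _ assms]) (auto simp: elem_sym_ext_apply)
  moreover have "{a, b} = {None} \<longleftrightarrow> a = None \<and> b = None" by auto
  ultimately show ?thesis
    unfolding Psi_matrix_def using True
    by (simp add: elem_sym_ext_apply multiplier_block_def C_mat_def B_mat_def A_mat_def
        direct_sum_def A_block_def elem_sym_def)
next
  case False
  then show ?thesis
    by (simp add: Psi_matrix_def elem_sym_ext_apply C_mat_def B_mat_def A_mat_def direct_sum_def)
qed

lemma multiplier_block_off_pattern:
  assumes G: "simple_graph V E" and "\<not> zero_pattern E a b"
  shows "multiplier_block V E y z t a b = 0"
proof -
  have "elem_sym ((\<lambda>u. Some (u, i)) ` e) a b = 0" if "e \<in> E" for i e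
  proof -
    have "\<exists>u\<in>V. \<exists>v\<in>V. u \<noteq> v \<and> e = {u, v}"
      using G that by (simp add: simple_graph_def)
    then obtain u v where e: "e = {u, v}" "u \<noteq> v" by auto
    have "{u, v} \<in> E" "{v, u} \<in> E"
      using that e(1) by (simp_all add: insert_commute)
    then have "{a, b} \<noteq> {Some (u, i), Some (v, i)}"
      using assms(2) e(2) by (auto simp: doubleton_eq_iff)
    then show ?thesis using e by (simp add: elem_sym_def)
  qed
  moreover have "elem_sym {Some (u, i), Some (u, j)} a b = 0" if "j \<noteq> i" for u i j
    using assms(2) that by (auto simp: elem_sym_def doubleton_eq_iff)
  ultimately show ?thesis by (simp add: multiplier_block_def)
qed

text \<open>The sum runs over ordered pairs of colours, so each symmetric position is met
  twice.\<close>

lemma multiplier_block_same_vertex: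
  assumes fin: "finite V" and u: "u \<in> V" and i: "i \<in> {1..t}" and j: "j \<in> {1..t}" and "i \<noteq> j"
  shows "multiplier_block V E y z t (Some (u, i)) (Some (u, j)) = z t u i j + z t u j i"
proof -
  let ?a = "Some (u, i)" and ?b = "Some (u, j)"
  have "{?a, ?b} \<noteq> (\<lambda>v. Some (v, k)) ` e" for k e
  proof
    assume "{?a, ?b} = (\<lambda>v. Some (v, k)) ` e"
    then have "?a \<in> (\<lambda>v. Some (v, k)) ` e" "?b \<in> (\<lambda>v. Some (v, k)) ` e" by blast+
    then show False using \<open>i \<noteq> j\<close> by auto
  qed
  then have 1: "elem_sym ((\<lambda>v. Some (v, k)) ` e) ?a ?b = 0" for k e
    by (simp add: elem_sym_def)
  have "elem_sym {Some (v, k), Some (v, l)} ?a ?b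
      = (if v = u \<and> {k, l} = {i, j} then 1 else 0)" for v k l
    by (auto simp: elem_sym_def doubleton_eq_iff)
  then have 2: "(\<Sum>v\<in>V. z t v k l * elem_sym {Some (v, k), Some (v, l)} ?a ?b)
      = (if {k, l} = {i, j} then z t u k l else 0)" for k l
    by (subst sum_single_term[OF fin u]) auto
  have 3: "(\<Sum>l\<in>{1..t} - {i}. if {i, l} = {i, j} then z t u i l else 0) = z t u i j"
    by (subst sum_single_term[of _ j]) (use j \<open>i \<noteq> j\<close> in \<open>auto simp: doubleton_eq_iff\<close>)
  have 4: "(\<Sum>l\<in>{1..t} - {j}. if {j, l} = {i, j} then z t u j l else 0) = z t u j i"
    by (subst sum_single_term[of _ i]) (use i \<open>i \<noteq> j\<close> in \<open>auto simp: doubleton_eq_iff\<close>)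
  have "(\<Sum>k = 1..t. \<Sum>l\<in>{1..t} - {k}. if {k, l} = {i, j} then z t u k l else 0)
      = (\<Sum>k\<in>{i, j}. \<Sum>l\<in>{1..t} - {k}. if {k, l} = {i, j} then z t u k l else 0)"
    using i j by (intro sum.mono_neutral_right) (auto simp: doubleton_eq_iff intro!: sum.neutral)
  also have "\<dots> = z t u i j + z t u j i"
    using \<open>i \<noteq> j\<close> 3 4 by simp
  finally show ?thesis by (simp add: multiplier_block_def 1 2)
qed

lemma multiplier_block_edge:
  assumes G: "simple_graph V E" and e: "{u, v} \<in> E" and i: "i \<in> {1..t}"
  shows "multiplier_block V E y z t (Some (u, i)) (Some (v, i)) = y t {u, v} i"
proof -
  let ?a = "Some (u, i)" and ?b = "Some (v, i)"
  have fin: "finite E"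
  proof (rule finite_subset)
    show "E \<subseteq> Pow V" using G by (auto simp: simple_graph_def)
    show "finite (Pow V)" using G by (simp add: simple_graph_def)
  qed
  have "u \<noteq> v" using G e by (auto simp: simple_graph_def doubleton_eq_iff)
  then have 1: "elem_sym {Some (w, k), Some (w, l)} ?a ?b = 0" for w k l
    by (auto simp: elem_sym_def doubleton_eq_iff)
  have img: "{?a, ?b} = (\<lambda>w. Some (w, k)) ` f \<longleftrightarrow> k = i \<and> f = {u, v}" for k f
  proof
    assume *: "{?a, ?b} = (\<lambda>w. Some (w, k)) ` f"
    then have "?a \<in> (\<lambda>w. Some (w, k)) ` f" by blast
    then have "k = i" by auto
    moreover have "(\<lambda>w. Some (w, i)) ` {u, v} = (\<lambda>w. Some (w, i)) ` f"
      using * \<open>k = i\<close> by simp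
    moreover have "inj (\<lambda>w. Some (w, i))" by (simp add: inj_def)
    ultimately show "k = i \<and> f = {u, v}" by (metis inj_image_eq_iff)
  qed auto
  have 2: "(\<Sum>f\<in>E. y t f k * elem_sym ((\<lambda>w. Some (w, k)) ` f) ?a ?b)
      = (if k = i then y t {u, v} i else 0)" for k
  proof -
    have "(\<Sum>f\<in>E. y t f k * elem_sym ((\<lambda>w. Some (w, k)) ` f) ?a ?b)
        = (\<Sum>f\<in>E. if f = {u, v} then (if k = i then y t {u, v} i else 0) else 0)"
      unfolding elem_sym_def img by (intro sum.cong) auto
    then show ?thesis using fin e by simp
  qed
  show ?thesis using i by (simp add: multiplier_block_def 1 2)
qed

text \<open>The free multipliers realise every family of symmetric matrices supported on the zero
  pattern, which lets the certificates be treated as plain matrices.\<close>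

lemma multipliers_exist:
  assumes G: "simple_graph V E"
    and sym: "\<And>t. t \<in> T \<Longrightarrow> symmetric_on (block_index V t) (Y t)"
    and off: "\<And>t a b. t \<in> T \<Longrightarrow> a \<in> block_index V t \<Longrightarrow> b \<in> block_index V t
      \<Longrightarrow> \<not> zero_pattern E a b \<Longrightarrow> Y t a b = 0"
  shows "\<exists>y z. \<forall>t\<in>T. \<forall>a\<in>block_index V t. \<forall>b\<in>block_index V t.
    multiplier_block V E y z t a b = Y t a b"
proof -
  \<comment> \<open>Some orientation of each edge; symmetry of \<open>Y\<close> makes the choice
    harmless.\<close>
  define ends where "ends e = (SOME p. e = {fst p, snd p})" for e :: "'a set"
  have ends: "{fst (ends {u, v}), snd (ends {u, v})} = {u, v}" for u v
    unfolding ends_def by (rule someI2[of _ "(u, v)"]) auto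
  define y where "y t e i = Y t (Some (fst (ends e), i)) (Some (snd (ends e), i))" for t e and i :: nat
  \<comment> \<open>Halved because \<open>z t u i j\<close> and \<open>z t u j i\<close> add up at
    the same position.\<close>
  define z where "z t u i j = Y t (Some (u, i)) (Some (u, j)) / 2" for t u and i j :: nat
  have fin: "finite V" using G by (simp add: simple_graph_def)
  have "multiplier_block V E y z t a b = Y t a b"
    if t: "t \<in> T" and a: "a \<in> block_index V t" and b: "b \<in> block_index V t" for t a b
  proof (cases "zero_pattern E a b")
    case False
    then show ?thesis using multiplier_block_off_pattern[OF G False] off[OF t a b False] by simp
  next
    case True
    then obtain u i v j where ab: "a = Some (u, i)" "b = Some (v, j)"
      by (auto elim: zero_pattern.elims)
    then have in_ind: "u \<in> V" "v \<in> V" "i \<in> {1..t}" "j \<in> {1..t}"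
      using a b by (auto simp: block_index_def)
    have symY: "Y t b a = Y t a b"
      using sym[OF t] a b unfolding symmetric_on_def by blast
    show ?thesis
    proof (cases "u = v")
      case True
      then have "i \<noteq> j" using \<open>zero_pattern E a b\<close> ab by simp
      then show ?thesis
        using multiplier_block_same_vertex[OF fin in_ind(1,3,4)] True ab symY by (simp add: z_def)
    next
      case False
      then have ij: "i = j" and e: "{u, v} \<in> E" using \<open>zero_pattern E a b\<close> ab by auto
      have "ends {u, v} = (u, v) \<or> ends {u, v} = (v, u)"
        using ends[of u v] by (auto simp: doubleton_eq_iff prod_eq_iff)
      then have "y t {u, v} i = Y t a b"
        using ab ij symY by (auto simp: y_def)
      then show ?thesis using multiplier_block_edge[OF G e in_ind(3)] ab ij by simp
    qed
  qed
  then show ?thesis by blast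
qed


subsection \<open>The two bounds\<close>

text \<open>At the corner of block \<open>t\<close> stands \<open>t - l\<close>. Blocks with
  \<open>t \<ge> l\<close> are already semidefinite there, and the smaller ones are infeasible, so
  their certificates can pay for the deficit.\<close>

lemma Psi_matrix_lower:
  assumes G: "simple_graph V E" and \<epsilon>: "0 \<le> \<epsilon>"
    and l: "\<And>t. 1 \<le> t \<Longrightarrow> real t < l \<Longrightarrow> \<not> theta_plus_feasible V (complement_edges V E) (real t)"
  shows "\<exists>\<mu> y z. Psi_matrix V E l \<mu> y z \<in> K_nc \<epsilon> (full_index V)"
proof -
  have fin: "finite V" using G by (simp add: simple_graph_def)
  let ?T = "{1..card V}"
  let ?B = "block_index V"
  let ?E = "\<lambda>t a b :: 'a bidx. if a = None \<and> b = None then real t - l else 0"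
  have E00: "psd_on I (\<lambda>a b :: 'a bidx. if a = None \<and> b = None then c else 0)" if "0 \<le> c" for c I
  proof -
    let ?v = "\<lambda>a :: 'a bidx. if a = None then 1 else (0 :: real)"
    have "psd_on I (\<lambda>a b. c * (?v a * ?v b))" by (intro psd_on_scale psd_on_outer that)
    moreover have "(\<lambda>a b. c * (?v a * ?v b)) = (\<lambda>a b. if a = None \<and> b = None then c else 0)"
      by (auto simp: fun_eq_iff)
    ultimately show ?thesis by (simp only:)
  qed
  define certificate where "certificate t k Y N \<longleftrightarrow> 0 \<le> k \<and> symmetric_on (?B t) Y
    \<and> (\<forall>a\<in>?B t. \<forall>b\<in>?B t. \<not> zero_pattern E a b \<longrightarrow> Y a b = 0)
    \<and> symmetric_on (?B t) N \<and> (\<forall>a\<in>?B t. \<forall>b\<in>?B t. 0 \<le> N a b)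
    \<and> psd_on (?B t) (\<lambda>a b. k * A_block V a b + ?E t a b + Y a b - N a b)" for t k Y N
  have "\<exists>k Y N. certificate t k Y N" if t: "t \<in> ?T" for t
  proof (cases "real t < l")
    case False
    then have "psd_on (?B t) (\<lambda>a b. 0 * A_block V a b + ?E t a b + 0 - 0)"
      using E00[of "real t - l"] by simp
    then show ?thesis
      by (intro exI[of _ 0] exI[of _ "\<lambda>_ _. 0"])
        (simp add: certificate_def symmetric_on_def)
  next
    case True
    have "\<not> (\<exists>X. block_feasible V E t X)"
      using l[OF _ True] t block_feasible_imp_theta_plus_feasible[OF G] by auto
    from block_certificate[OF G this] obtain s Y N where
      s: "0 < s" and Y: "symmetric_on (?B t) Y"
      "\<forall>a\<in>?B t. \<forall>b\<in>?B t. \<not> zero_pattern E a b \<longrightarrow> Y a b = 0"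
      and N: "symmetric_on (?B t) N" "\<forall>a\<in>?B t. \<forall>b\<in>?B t. 0 \<le> N a b"
      and psd: "psd_on (?B t) (\<lambda>a b. A_block V a b - (if a = None \<and> b = None then s else 0)
        + Y a b - N a b)" by blast
    \<comment> \<open>Scales the gap \<open>s\<close> of the certificate to exactly the deficit
      \<open>l - t\<close>.\<close>
    define k where "k = (l - real t) / s"
    have k: "0 \<le> k" "k * s = l - real t" using s True by (simp_all add: k_def)
    have "(\<lambda>a b. k * (A_block V a b - (if a = None \<and> b = None then s else 0) + Y a b - N a b))
        = (\<lambda>a b. k * A_block V a b + ?E t a b + k * Y a b - k * N a b)"
      using k(2) by (auto simp: fun_eq_iff algebra_simps)
    with psd_on_scale[OF psd k(1)]
    have "psd_on (?B t) (\<lambda>a b. k * A_block V a b + ?E t a b + k * Y a b - k * N a b)"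
      by (simp only:)
    moreover have "symmetric_on (?B t) (\<lambda>a b. k * Y a b)" "symmetric_on (?B t) (\<lambda>a b. k * N a b)"
      using Y(1) N(1) unfolding symmetric_on_def by metis+
    ultimately show ?thesis
      unfolding certificate_def using k(1) Y(2) N(2)
      by (intro exI[of _ k] exI[of _ "\<lambda>a b. k * Y a b"] exI[of _ "\<lambda>a b. k * N a b"]) auto
  qed
  then obtain k Y N where "\<And>t. t \<in> ?T \<Longrightarrow> certificate t (k t) (Y t) (N t)"
    by metis
  then have k: "\<And>t. t \<in> ?T \<Longrightarrow> 0 \<le> k t" and Y: "\<And>t. t \<in> ?T \<Longrightarrow> symmetric_on (?B t) (Y t)"
    "\<And>t a b. t \<in> ?T \<Longrightarrow> a \<in> ?B t \<Longrightarrow> b \<in> ?B t \<Longrightarrow> \<not> zero_pattern E a b \<Longrightarrow> Y t a b = 0"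
    and N: "\<And>t. t \<in> ?T \<Longrightarrow> symmetric_on (?B t) (N t)"
    "\<And>t a b. t \<in> ?T \<Longrightarrow> a \<in> ?B t \<Longrightarrow> b \<in> ?B t \<Longrightarrow> 0 \<le> N t a b"
    and psd: "\<And>t. t \<in> ?T \<Longrightarrow>
      psd_on (?B t) (\<lambda>a b. k t * A_block V a b + ?E t a b + Y t a b - N t a b)"
    unfolding certificate_def by blast+
  \<comment> \<open>Any number at least every \<open>k t\<close> would do for
    \<open>- \<mu>\<close>, and the sum of nonnegative numbers is one: the surplus multiple of
    \<open>A_block V\<close> in each block is positive semidefinite.\<close>
  define \<mu> where "\<mu> = - (\<Sum>t\<in>?T. k t)"
  \<comment> \<open>The sign is flipped because \<open>Psi_matrix\<close> subtracts the
    multipliers.\<close>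
  have "\<exists>y z. \<forall>t\<in>?T. \<forall>a\<in>?B t. \<forall>b\<in>?B t. multiplier_block V E y z t a b = - Y t a b"
  proof (rule multipliers_exist[OF G])
    fix t assume "t \<in> ?T"
    then show "symmetric_on (?B t) (\<lambda>a b. - Y t a b)"
      using Y(1) unfolding symmetric_on_def by metis
  qed (use Y(2) in auto)
  then obtain y z where yz: "\<And>t a b. t \<in> ?T \<Longrightarrow> a \<in> ?B t \<Longrightarrow> b \<in> ?B t \<Longrightarrow>
      multiplier_block V E y z t a b = - Y t a b" by blast
  let ?M = "Psi_matrix V E l \<mu> y z"
  let ?N = "\<lambda>p q. if fst p = fst q then N (fst p) (snd p) (snd q) else 0"
  let ?D = "\<lambda>t a b. - \<mu> * A_block V a b + ?E t a b + Y t a b - N t a b"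
  have psdD: "psd_on (?B t) (?D t)" if t: "t \<in> ?T" for t
  proof -
    have "k t \<le> - \<mu>"
      unfolding \<mu>_def using member_le_sum[OF t, of k] k by simp
    then have "psd_on (?B t) (\<lambda>a b. (k t * A_block V a b + ?E t a b + Y t a b - N t a b)
        + (- \<mu> - k t) * A_block V a b)"
      by (intro psd_on_add psd[OF t] psd_on_scale psd_on_A_block) simp
    moreover have "(\<lambda>a b. (k t * A_block V a b + ?E t a b + Y t a b - N t a b)
        + (- \<mu> - k t) * A_block V a b) = ?D t"
      by (simp add: fun_eq_iff algebra_simps)
    ultimately show ?thesis by (simp only:)
  qed
  have diff: "?M p q - ?N p q = (if fst p = fst q then ?D (fst p) (snd p) (snd q) else 0)"
    if "p \<in> full_index V" "q \<in> full_index V" for p q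
    using that yz by (cases p; cases q) (auto simp: full_index_def Psi_matrix_block)
  have "?M \<in> K_nc \<epsilon> (full_index V)"
  proof (rule K_nc_psd_plus_nonneg)
    show "finite (full_index V)" by (rule card_full_index(1)[OF fin])
    have "psd_on (full_index V) (\<lambda>p q. if fst p = fst q then ?D (fst p) (snd p) (snd q) else 0)"
      unfolding full_index_def by (intro psd_on_Sigma finite_block_index[OF fin] psdD) simp
    then show psdM: "psd_on (full_index V) (\<lambda>p q. ?M p q - ?N p q)"
      by (subst psd_on_cong) (rule diff)
    show "symmetric_on (full_index V) ?M"
      unfolding symmetric_on_def
    proof (intro ballI)
      fix p q assume pq: "p \<in> full_index V" "q \<in> full_index V"
      have "?N p q = ?N q p"
        using N(1) pq by (cases p; cases q) (auto simp: full_index_def symmetric_on_def)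
      then show "?M p q = ?M q p"
        using psd_on_sym[OF psdM pq] by linarith
    qed
    show "0 \<le> ?N p q" if "p \<in> full_index V" "q \<in> full_index V" for p q
      using that N(2) by (cases p; cases q) (auto simp: full_index_def)
  qed (rule \<epsilon>)
  then show ?thesis by blast
qed

text \<open>Weak duality: pairing with \<open>X\<close> in block \<open>t\<close> and zero in the
  others kills the multipliers and the \<open>A\<close> term and leaves
  \<open>t - l\<close>.\<close>

lemma Psi_matrix_upper:
  assumes G: "simple_graph V E" and t: "t \<in> {1..card V}" and X: "block_feasible V E t X"
    and M: "Psi_matrix V E l \<mu> y z \<in> K_nc 0 (full_index V)"
  shows "l \<le> real t"
proof -
  have fin: "finite V" using G by (simp add: simple_graph_def)
  let ?T = "{1..card V}"
  let ?B = "block_index V"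
  let ?M = "Psi_matrix V E l \<mu> y z"
  have dnn: "dnn_on (?B t) X" and X00: "X None None = 1"
    and inner: "mat_inner (?B t) (A_block V) X = 0"
    and zero: "\<And>a b. a \<in> ?B t \<Longrightarrow> b \<in> ?B t \<Longrightarrow> zero_pattern E a b \<Longrightarrow> X a b = 0"
    using X by (auto simp: block_feasible_def)
  define D where "D s = (if s = t then X else (\<lambda>_ _. 0))" for s
  let ?X = "\<lambda>p q. if fst p = fst q then D (fst p) (snd p) (snd q) else 0"
  have "psd_on (full_index V) ?X"
    unfolding full_index_def using dnn
    by (intro psd_on_Sigma) (auto simp: finite_block_index[OF fin] D_def dnn_on_def psd_on_zero)
  then have "dnn_on (full_index V) ?X"
    using dnn by (auto simp: dnn_on_def D_def full_index_def)
  then have "0 \<le> mat_inner (full_index V) ?M ?X"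
    using K_nc_zero_pairing[OF card_full_index(1)[OF fin] M] by blast
  also have "mat_inner (full_index V) ?M ?X
      = (\<Sum>a\<in>?B t. \<Sum>b\<in>?B t. ?M (t, a) (t, b) * X a b)"
  proof -
    have Sigma: "(\<Sum>p\<in>full_index V. g p) = (\<Sum>s\<in>?T. \<Sum>a\<in>?B s. g (s, a))" for g :: "_ \<Rightarrow> real"
      unfolding full_index_def using finite_block_index[OF fin] by (simp add: sum.Sigma)
    have "mat_inner (full_index V) ?M ?X = (\<Sum>s\<in>?T. \<Sum>a\<in>?B s. \<Sum>r\<in>?T. \<Sum>b\<in>?B r.
        ?M (s, a) (r, b) * (if s = r then D s a b else 0))"
      unfolding mat_inner_def Sigma by (simp only: fst_conv snd_conv)
    also have "\<dots> = (\<Sum>a\<in>?B t. \<Sum>r\<in>?T. \<Sum>b\<in>?B r.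
        ?M (t, a) (r, b) * (if t = r then D t a b else 0))"
      by (rule sum_single_term[OF _ t]) (auto simp: D_def intro!: sum.neutral)
    also have "\<dots> = (\<Sum>a\<in>?B t. \<Sum>b\<in>?B t. ?M (t, a) (t, b) * (if t = t then D t a b else 0))"
      by (intro sum.cong refl sum_single_term[OF _ t]) auto
    finally show ?thesis by (simp add: D_def)
  qed
  also have "\<dots> = (\<Sum>a\<in>?B t. \<Sum>b\<in>?B t. (if a = None \<and> b = None then (real t - l) * X a b else 0)
      - \<mu> * (A_block V a b * X a b))"
  proof (intro sum.cong refl)
    fix a b assume ab: "a \<in> ?B t" "b \<in> ?B t"
    have "multiplier_block V E y z t a b * X a b = 0"
      using multiplier_block_off_pattern[OF G, of a b] zero[OF ab] by (cases "zero_pattern E a b") auto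
    then show "?M (t, a) (t, b) * X a b = (if a = None \<and> b = None then (real t - l) * X a b else 0)
      - \<mu> * (A_block V a b * X a b)"
      by (auto simp: Psi_matrix_block[OF t] algebra_simps)
  qed
  also have "\<dots> = (real t - l) * X None None - \<mu> * mat_inner (?B t) (A_block V) X"
    using sum_sum_single[OF finite_block_index[OF fin, of t], of None "\<lambda>a b. (real t - l) * X a b"]
    by (simp add: sum_subtractf mat_inner_def sum_distrib_left block_index_def)
  finally show ?thesis using X00 inner by simp
qed

theorem lemma4p18:
  fixes V :: "'v set" and E :: "'v set set" and \<epsilon> :: real
  assumes "simple_graph V E" and "\<epsilon> \<ge> 0"
  shows "ereal (real_of_int \<lceil>theta_plus V (complement_edges V E)\<rceil>) \<le> Psi \<epsilon> V E
    \<and> (\<epsilon> = 0 \<longrightarrow> ereal (real_of_int \<lceil>theta_plus V (complement_edges V E)\<rceil>) = Psi \<epsilon> V E)"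
proof -
  let ?E' = "complement_edges V E"
  let ?\<theta> = "theta_plus V ?E'"
  have V: "finite V" "V \<noteq> {}" using assms(1) by (auto simp: simple_graph_def)
  note feasible = theta_plus_least(1)[OF V, of ?E']
  have "1 \<le> ?\<theta>" by (rule theta_plus_feasible_ge_1[OF V feasible])
  moreover have "?\<theta> \<le> real (card V)"
    by (rule theta_plus_least(2)[OF V theta_plus_feasible_card[OF V(1)]])
  \<comment> \<open>The bounds 1 and \<open>n\<close> on theta-plus ensure that its ceiling is the
    number of one of the blocks.\<close>
  moreover define t where "t = nat \<lceil>?\<theta>\<rceil>"
  ultimately have t: "real_of_int \<lceil>?\<theta>\<rceil> = real t" "t \<in> {1..card V}" "?\<theta> \<le> real t"
    by (auto simp: t_def le_nat_iff nat_le_iff ceiling_le_iff le_ceiling_iff)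
  have "\<not> theta_plus_feasible V ?E' (real s)" if "real s < real t" for s
  proof
    assume "theta_plus_feasible V ?E' (real s)"
    from theta_plus_least(2)[OF V this] have "\<lceil>?\<theta>\<rceil> \<le> int s" by (simp add: ceiling_le_iff)
    then show False using that t(1) by linarith
  qed
  then obtain \<mu> y z where "Psi_matrix V E (real t) \<mu> y z \<in> K_nc \<epsilon> (full_index V)"
    using Psi_matrix_lower[OF assms, of "real t"] by blast
  then have lower: "ereal (real t) \<le> Psi \<epsilon> V E"
    unfolding Psi_def by (intro Sup_upper) blast
  have upper: "Psi \<epsilon> V E \<le> ereal (real t)" if "\<epsilon> = 0"
  proof -
    have "theta_plus_feasible V ?E' (real t)"
      by (rule theta_plus_feasible_mono[OF V(1) feasible t(3)])
    then obtain X where X: "block_feasible V E t X"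
      using theta_plus_feasible_imp_block_feasible[OF assms(1)] t(2) by auto
    show ?thesis
      unfolding Psi_def using Psi_matrix_upper[OF assms(1) t(2) X] that
      by (intro Sup_least) auto
  qed
  show ?thesis using lower upper t(1) by auto
qed

end
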